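(* Let $f=\{f_w\}_w$ be a continuous random dynamical system (RDS) generated by homeomorphisms $f_w:X\to X$ for all $w\in\Omega$ (so that $\mathcal{E}=\Omega\times X$ and $\mathcal{E}_w=X$ for all $w$). The following statements are equivalent: (i) $f$ is random countably-expansive; (ii) $f$ is random measure-expansive.
   Context: Setting. $(\Omega,\mathcal{F},\mathbb{P})$ is a Polish space with a probability measure, $\theta:\Omega\to\Omega$ is an invertible $\mathbb{P}$-preserving map, $X$ is a compact metric space with distance $d$ and Borel $\sigma$-algebra $\mathcal{B}$. The RDS $f=\{f_w\}_w$ consists of maps $f_w:X\to X$ such that $(w,x)\mapsto f_w(x)$ is measurable and $x\mapsto f_w(x)$ is continuous for $\mathbb{P}$-a.e. $w$. For $n\ge1$, $f_w^n=f_{\theta^{n-1}(w)}\circ\cdots\circ f_w$, $f_w^0=\mathrm{Id}$, and for $n\le-1$, $f_w^n=(f_{\theta^n(w)})^{-1}\circ\cdots\circ(f_{\theta^{-1}(w)})^{-1}$. Measures. $\mathcal{P}_{\mathbb{P}}(\Omega\times X)$ is the set of probability measures $\mu$ on $(\Omega\times X,\mathcal{F}\times\mathcal{B})$ with marginal $\mathbb{P}$ on $\Omega$. Each such $\mu$ disintegrates as $d\mu(w,x)=d\mu_w(x)\,d\mathbb{P}(w)$ with $\mu_w$ a probability measure on $X$ for $\mathbb{P}$-a.e. $w$. $\mu$ has non-atomic factorization if $\mu_w$ is non-atomic for $\mathbb{P}$-a.e. $w$. Expansivity. A random variable is a measurable function $\delta:\Omega\to(0,+\infty)$. $\Gamma_\delta(x,w)=\{y\in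 X: d(f_w^k(x),f_w^k(y))\le\delta(\theta^k(w))\text{ for all }k\in\mathbb{Z}\}$. - $\mu\in\mathcal{P}_{\mathbb{P}}(\Omega\times X)$ is random expansive if there is a random variable $\delta:\Omega\to(0,+\infty)$ such that for $\mathbb{P}$-a.e. $w$ one has $\mu_w(\Gamma_\delta(x,w))=0$ for all $x\in X$. - $f$ is random countably-expansive if there is a random variable $\delta:\Omega\to(0,+\infty)$ such that for $\mathbb{P}$-a.e. $w$ the set $\Gamma_\delta(x,w)$ is countable for all $x\in X$. - $f$ is random measure-expansive if every Borel probability measure $\mu\in\mathcal{P}_{\mathbb{P}}(\Omega\times X)$ with non-atomic factorization is random expansive. *)

theory Defs
  imports "HOL-Probability.Probability"
begin

text \<open>The base map \<open>theta\<close> is assumed bijective wherever negative powers are used.\<close>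

definition base_pow :: "('w \<Rightarrow> 'w) \<Rightarrow> int \<Rightarrow> 'w \<Rightarrow> 'w" where
  "base_pow theta k = (if k \<ge> 0 then theta ^^ nat k else inv theta ^^ nat (- k))"

fun forward_iter :: "('w \<Rightarrow> 'w) \<Rightarrow> ('w \<Rightarrow> 'x \<Rightarrow> 'x) \<Rightarrow> nat \<Rightarrow> 'w \<Rightarrow> 'x \<Rightarrow> 'x" where
  "forward_iter theta f 0 w = id"
| "forward_iter theta f (Suc n) w = f (base_pow theta (int n) w) \<circ> forward_iter theta f n w"

fun backward_iter :: "('w \<Rightarrow> 'w) \<Rightarrow> ('w \<Rightarrow> 'x \<Rightarrow> 'x) \<Rightarrow> nat \<Rightarrow> 'w \<Rightarrow> 'x \<Rightarrow> 'x" where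
  "backward_iter theta f 0 w = id"
| "backward_iter theta f (Suc n) w =
     inv (f (base_pow theta (- int (Suc n)) w)) \<circ> backward_iter theta f n w"

definition rds_iter :: "('w \<Rightarrow> 'w) \<Rightarrow> ('w \<Rightarrow> 'x \<Rightarrow> 'x) \<Rightarrow> int \<Rightarrow> 'w \<Rightarrow> 'x \<Rightarrow> 'x" where
  "rds_iter theta f k w =
     (if k \<ge> 0 then forward_iter theta f (nat k) w else backward_iter theta f (nat (- k)) w)"

definition dyn_ball ::
  "('w \<Rightarrow> 'w) \<Rightarrow> ('w \<Rightarrow> 'x::metric_space \<Rightarrow> 'x) \<Rightarrow> ('w \<Rightarrow> real) \<Rightarrow> 'x \<Rightarrow> 'w \<Rightarrow> 'x set" where
  "dyn_ball theta f \<delta> x w =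
     {y. \<forall>k::int. dist (rds_iter theta f k w x) (rds_iter theta f k w y) \<le> \<delta> (base_pow theta k w)}"

text \<open>Dynamical balls are closed, hence Borel, so that measuring them below is meaningful.\<close>

lemma closed_dyn_ball:
  fixes f :: "'w \<Rightarrow> 'x::metric_space \<Rightarrow> 'x"
  assumes "\<And>w. homeomorphism UNIV UNIV (f w) (inv (f w))"
  shows "closed (dyn_ball theta f \<delta> x w)"
proof -
  have c: "continuous_on A (f w)" "continuous_on A (inv (f w))" for w A
    using assms[of w] by (auto simp: homeomorphism_def intro: continuous_on_subset)
  have F: "continuous_on UNIV (forward_iter theta f n w)" for n
    by (induction n) (auto intro: continuous_on_compose c simp: id_def simp del: o_apply)
  have B: "continuous_on UNIV (backward_iter theta f n w)" for n
    by (induction n) (auto intro: continuous_on_compose c simp: id_def simp del: o_apply)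
  have I: "continuous_on UNIV (rds_iter theta f k w)" for k
    by (simp add: rds_iter_def F B)
  show ?thesis
    unfolding dyn_ball_def
    by (intro closed_Collect_all closed_Collect_le continuous_intros I)
qed

definition marginal_measures :: "'w measure \<Rightarrow> ('w \<times> 'x::topological_space) measure set" where
  "marginal_measures P =
     {\<mu>. prob_space \<mu> \<and> sets \<mu> = sets (P \<Otimes>\<^sub>M (borel :: 'x measure)) \<and> distr \<mu> P fst = P}"

definition disintegration ::
  "'w measure \<Rightarrow> ('w \<times> 'x::topological_space) measure \<Rightarrow> ('w \<Rightarrow> 'x measure) \<Rightarrow> bool" where
  "disintegration P \<mu> \<kappa> \<longleftrightarrow>
     \<kappa> \<in> P \<rightarrow>\<^sub>M prob_algebra borel \<and>
     (\<forall>C\<in>sets \<mu>. emeasure \<mu> C = (\<integral>\<^sup>+ w. emeasure (\<kappa> w) (Pair w -` C) \<partial>P))"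

text \<open>Disintegrations are unique up to null sets, so the existential quantifiers over
  disintegrations below do not depend on the choice of a version.\<close>

lemma disintegration_unique:
  fixes \<mu> :: "('w \<times> 'x::second_countable_topology) measure"
  assumes P: "prob_space P" and \<mu>: "\<mu> \<in> marginal_measures P"
    and k: "disintegration P \<mu> \<kappa>" and k': "disintegration P \<mu> \<kappa>'"
  shows "AE w in P. \<kappa> w = \<kappa>' w"
proof -
  interpret prob_space P by fact
  have m: "\<kappa> \<in> P \<rightarrow>\<^sub>M prob_algebra borel" "\<kappa>' \<in> P \<rightarrow>\<^sub>M prob_algebra borel"
    using k k' by (auto simp: disintegration_def)
  have ms: "(\<lambda>w. emeasure (q w) B) \<in> borel_measurable P"
    if "q \<in> P \<rightarrow>\<^sub>M prob_algebra borel" "B \<in> sets borel" for q :: "'w \<Rightarrow> 'x measure" and B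
    using that measurable_emeasure_kernel measurable_prob_algebraD by blast
  have s\<mu>: "sets \<mu> = sets (P \<Otimes>\<^sub>M (borel :: 'x measure))"
    using \<mu> by (simp add: marginal_measures_def)
  have rect: "(\<integral>\<^sup>+ w. emeasure (q w) B * indicator A w \<partial>P) = emeasure \<mu> (A \<times> B)"
    if "disintegration P \<mu> q" "A \<in> sets P" "B \<in> sets borel" for q A B
  proof -
    have "A \<times> B \<in> sets \<mu>" using that s\<mu> by auto
    then have "emeasure \<mu> (A \<times> B) = (\<integral>\<^sup>+ w. emeasure (q w) (Pair w -` (A \<times> B)) \<partial>P)"
      using that(1) by (auto simp: disintegration_def)
    also have "\<dots> = (\<integral>\<^sup>+ w. emeasure (q w) B * indicator A w \<partial>P)"
      by (intro nn_integral_cong) (auto split: split_indicator)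
    finally show ?thesis by simp
  qed
  have eqB: "AE w in P. emeasure (\<kappa> w) B = emeasure (\<kappa>' w) B" if B: "B \<in> sets borel" for B
  proof (rule density_unique)
    show "density P (\<lambda>w. emeasure (\<kappa> w) B) = density P (\<lambda>w. emeasure (\<kappa>' w) B)"
      by (rule measure_eqI) (simp_all add: emeasure_density ms m B rect[OF k] rect[OF k'])
  qed (use ms m B in auto)
  obtain D :: "'x set set" where D: "countable D" and Dsub: "topological_basis D"
    using ex_countable_basis by blast
  define G where "G = (\<Inter>) ` {F. finite F \<and> F \<subseteq> D}"
  have cG: "countable G"
    unfolding G_def using countable_Collect_finite_subset[OF D] by simp
  have oG: "open g" if "g \<in> G" for g
    using that Dsub by (auto simp: G_def topological_basis_open intro!: open_Inter)
  have "D \<subseteq> G" 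
  proof
    fix b assume "b \<in> D" then have "\<Inter>{b} \<in> G" unfolding G_def by blast
    then show "b \<in> G" by simp
  qed
  have "topological_basis G"
    using Dsub \<open>D \<subseteq> G\<close> oG unfolding topological_basis_def by (meson order_trans)
  then have bG: "(borel :: 'x measure) = sigma UNIV G"
    using borel_eq_countable_basis[OF cG] by blast
  have sG: "sets (borel :: 'x measure) = sigma_sets UNIV G"
    unfolding bG by (rule sets_measure_of) simp
  have iG: "Int_stable G"
    unfolding Int_stable_def
  proof (intro ballI)
    fix a b assume "a \<in> G" "b \<in> G"
    then obtain F F' where "finite F" "F \<subseteq> D" "a = \<Inter>F" "finite F'" "F' \<subseteq> D" "b = \<Inter>F'"
      by (auto simp: G_def)
    then have "a \<inter> b = \<Inter>(F \<union> F')" "F \<union> F' \<in> {F. finite F \<and> F \<subseteq> D}" by auto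
    then show "a \<inter> b \<in> G" unfolding G_def by blast
  qed
  have "\<Inter>{} \<in> G" unfolding G_def by blast
  then have UG: "UNIV \<in> G" by simp
  have "AE w in P. \<forall>g\<in>G. emeasure (\<kappa> w) g = emeasure (\<kappa>' w) g"
    using cG by (subst AE_ball_countable) (auto intro!: eqB borel_open oG)
  then show ?thesis
  proof (rule AE_mp, intro AE_I2 impI)
    fix w assume w: "w \<in> space P" and E: "\<forall>g\<in>G. emeasure (\<kappa> w) g = emeasure (\<kappa>' w) g"
    have p: "prob_space (\<kappa> w)" "sets (\<kappa> w) = sets borel" "sets (\<kappa>' w) = sets borel"
      using measurable_space[OF m(1) w] measurable_space[OF m(2) w]
      by (auto simp: space_prob_algebra)
    interpret K: prob_space "\<kappa> w" by fact
    show "\<kappa> w = \<kappa>' w"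
      by (rule measure_eqI_generator_eq[OF iG, where \<Omega>=UNIV and A="\<lambda>_. UNIV"])
        (use E UG p sG in auto)
  qed
qed

definition measure_atom :: "'a measure \<Rightarrow> 'a set \<Rightarrow> bool" where
  "measure_atom M A \<longleftrightarrow> A \<in> sets M \<and> emeasure M A > 0 \<and>
     (\<forall>B\<in>sets M. B \<subseteq> A \<longrightarrow> emeasure M B = 0 \<or> emeasure M B = emeasure M A)"

definition nonatomic :: "'a measure \<Rightarrow> bool" where
  "nonatomic M \<longleftrightarrow> (\<nexists>A. measure_atom M A)"

definition nonatomic_factorization ::
  "'w measure \<Rightarrow> ('w \<times> 'x::topological_space) measure \<Rightarrow> bool" where
  "nonatomic_factorization P \<mu> \<longleftrightarrow>
     (\<exists>\<kappa>. disintegration P \<mu> \<kappa> \<and> (AE w in P. nonatomic (\<kappa> w)))"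

definition positive_rv :: "'w measure \<Rightarrow> ('w \<Rightarrow> real) \<Rightarrow> bool" where
  "positive_rv P \<delta> \<longleftrightarrow> \<delta> \<in> borel_measurable P \<and> (\<forall>w\<in>space P. \<delta> w > 0)"

definition random_expansive_measure ::
  "'w measure \<Rightarrow> ('w \<Rightarrow> 'w) \<Rightarrow> ('w \<Rightarrow> 'x::metric_space \<Rightarrow> 'x) \<Rightarrow> ('w \<times> 'x) measure \<Rightarrow> bool" where
  "random_expansive_measure P theta f \<mu> \<longleftrightarrow>
     (\<exists>\<delta> \<kappa>. positive_rv P \<delta> \<and> disintegration P \<mu> \<kappa> \<and>
        (AE w in P. \<forall>x. emeasure (\<kappa> w) (dyn_ball theta f \<delta> x w) = 0))"

definition random_countably_expansive ::
  "'w measure \<Rightarrow> ('w \<Rightarrow> 'w) \<Rightarrow> ('w \<Rightarrow> 'x::metric_space \<Rightarrow> 'x) \<Rightarrow> bool" where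
  "random_countably_expansive P theta f \<longleftrightarrow>
     (\<exists>\<delta>. positive_rv P \<delta> \<and> (AE w in P. \<forall>x. countable (dyn_ball theta f \<delta> x w)))"

definition random_measure_expansive ::
  "'w measure \<Rightarrow> ('w \<Rightarrow> 'w) \<Rightarrow> ('w \<Rightarrow> 'x::metric_space \<Rightarrow> 'x) \<Rightarrow> bool" where
  "random_measure_expansive P theta f \<longleftrightarrow>
     (\<forall>\<mu>\<in>marginal_measures P. nonatomic_factorization P \<mu> \<longrightarrow> random_expansive_measure P theta f \<mu>)"

text \<open>The state space is a whole type. Its sort \<open>polish_space\<close> costs no generality next to
  compactness, as compact metric spaces are complete and second countable. The base \<open>\<sigma>\<close>-algebra
  is the Borel one. An invertible measure-preserving map has a measurable inverse; for bijective
  Borel maps of Polish spaces this is automatic by the Lusin--Souslin theorem.\<close>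

locale continuous_homeo_rds =
  fixes P :: "'w::polish_space measure"
    and theta :: "'w \<Rightarrow> 'w"
    and f :: "'w \<Rightarrow> 'x::polish_space \<Rightarrow> 'x"
  assumes prob_space_P: "prob_space P"
    and sets_P: "sets P = sets borel"
    and bij_theta: "bij theta"
    and measurable_theta: "theta \<in> P \<rightarrow>\<^sub>M P"
    and measurable_inv_theta: "inv theta \<in> P \<rightarrow>\<^sub>M P"
    and theta_preserving: "distr P P theta = P"
    and compact_X: "compact (UNIV :: 'x set)"
    and measurable_f: "(\<lambda>(w, x). f w x) \<in> P \<Otimes>\<^sub>M borel \<rightarrow>\<^sub>M borel"
    and homeo_f: "\<And>w. homeomorphism UNIV UNIV (f w) (inv (f w))"

end

theory Submission
  imports Defs "HOL-Real_Asymp.Real_Asymp"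
begin

text \<open>
  A non-atomic measure does not charge countable sets, so random countable expansivity implies
  random measure expansivity with the same \<open>\<delta>\<close> (\<open>countably_imp_measure_expansive\<close>). The converse
  asks for one measure that defeats every random variable \<open>\<delta>\<close> at once, and in
  general no countable family of random variables goes below all others. What rescues the argument is a dichotomy between periodic and
  aperiodic points of the base.

  Along an aperiodic orbit every system is expansive, whatever the fibre maps are. There is a
  decreasing sequence of sets \<open>A n\<close> in the base that all meet every orbit and whose intersection
  is null on the aperiodic part. If \<open>\<delta>\<close> is tiny on \<open>A n\<close>, then an orbit that visits \<open>A n\<close> at time \<open>k\<close>
  forces \<open>f\<^sup>k x\<close> and \<open>f\<^sup>k y\<close> to be so close that, by uniform continuity of the inverse of
  \<open>f\<^sup>k\<close> on the compact fibre, \<open>x\<close> and \<open>y\<close> are within \<open>1 / n\<close>. A Borel-Cantelli choice of the sizes makes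
  a single \<open>\<delta>\<close> work almost surely (\<open>aperiodic_expansive\<close>).

  Over a periodic point \<open>\<delta>\<close> takes finitely many positive values along the orbit, so it may be replaced by
  a constant \<open>1 / (n + 1)\<close>, and only countably many sets matter: the points \<open>w\<close> over which some dynamical
  ball of constant radius \<open>1 / (n + 1)\<close> is uncountable. Such a set is analytic. It is the result of a
  Suslin operation, because uncountability of a compact set means the existence of a Cantor scheme
  inside it, and the countable codes of Cantor schemes are branches of a tree with measurable
  conditions. The argument of Choquet's capacitability theorem then gives, for each \<open>n\<close>, measurable sets
  \<open>C\<close> inside and \<open>H\<close> outside that differ by a null set, together with a measurable choice, for
  \<open>w \<in> C\<close>, of an injection of the unit interval into one uncountable ball
  (\<open>uncountable_section_uniformization\<close>).

  If almost no periodic \<open>w\<close> lies in all the sets \<open>H\<close>, then the least \<open>n\<close> for which \<open>w\<close> is outside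
  \<open>H\<close>, maximised over the orbit, is a measurable radius with countable balls
  (\<open>countably_expansive_if_hulls_null\<close>). Otherwise the images of Lebesgue measure under the chosen injections,
  averaged over \<open>n\<close>, form a non-atomic kernel over a set of positive measure that charges some ball for
  every \<open>\<delta>\<close> (\<open>not_measure_expansive_if_scrambled\<close>).
\<close>

section \<open>Suslin sets and measurable choice of branches\<close>

lemma dependent_list_choice:
  assumes "P []" and step: "\<And>p. P p \<Longrightarrow> \<exists>i. P (p @ [i])"
  obtains \<sigma> :: "nat \<Rightarrow> 'a" where "\<And>n. P (map \<sigma> [0..<n])"
proof -
  have "\<exists>F. \<forall>n. (length (F n) = n \<and> P (F n)) \<and> (\<exists>i. F (Suc n) = F n @ [i])"
  proof (rule dependent_nat_choice)
    show "\<exists>p. length p = 0 \<and> P p" using assms(1) by simp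
    show "\<exists>q. (length q = Suc n \<and> P q) \<and> (\<exists>i. q = p @ [i])" if p: "length p = n \<and> P p" for p n
    proof -
      obtain i where "P (p @ [i])" using step p by blast
      then show ?thesis using p by (intro exI[of _ "p @ [i]"]) simp
    qed
  qed
  then obtain F where F: "\<And>n. length (F n) = n" "\<And>n. P (F n)" "\<And>n. \<exists>i. F (Suc n) = F n @ [i]"
    by blast
  define \<sigma> where "\<sigma> n = last (F (Suc n))" for n
  have step: "F (Suc n) = F n @ [\<sigma> n]" for n
    using F(3)[of n] by (auto simp: \<sigma>_def)
  have eq: "F n = map \<sigma> [0..<n]" for n
  proof (induction n)
    case 0 then show ?case using F(1)[of 0] by simp
  next
    case (Suc n)
    then show ?case by (simp add: step)
  qed
  show thesis by (rule that[of \<sigma>]) (metis eq F(2))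
qed

lemma finite_bounded_lists: "finite {p :: nat list. length p = n \<and> (\<forall>i<n. p ! i \<le> \<tau> i)}"
proof (rule finite_subset)
  show "{p :: nat list. length p = n \<and> (\<forall>i<n. p ! i \<le> \<tau> i)}
      \<subseteq> {p. set p \<subseteq> {..Max (\<tau> ` {..n})} \<and> length p = n}"
  proof clarsimp
    fix p x assume p: "\<forall>i<length p. p ! i \<le> \<tau> i" and "x \<in> set p"
    then obtain i where i: "i < length p" "x = p ! i" by (auto simp: in_set_conv_nth)
    have "\<tau> i \<le> Max (\<tau> ` {..length p})" using i by (intro Max_ge) auto
    moreover have "x \<le> \<tau> i" using p i by simp
    ultimately show "x \<le> Max (\<tau> ` {..length p})" by (rule order_trans[rotated])
  qed
  show "finite {p. set p \<subseteq> {..Max (\<tau> ` {..n})} \<and> length p = n}"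
    by (rule finite_lists_length_eq) simp
qed

text \<open>The Suslin operation, restricted to the space of the measure: these are the analytic sets over a
  measurable space. Branches are arbitrary sequences of naturals, of which there are uncountably many,
  so the result need not be measurable even if every \<open>S p\<close> is.\<close>

definition suslin :: "'w measure \<Rightarrow> (nat list \<Rightarrow> 'w set) \<Rightarrow> 'w set" where
  "suslin M S = {w \<in> space M. \<exists>\<sigma>. \<forall>n. w \<in> S (map \<sigma> [0..<n])}"

lemma suslin_subset_space: "suslin M S \<subseteq> space M"
  by (auto simp: suslin_def)

text \<open>If the branches are bounded by a fixed sequence \<open>\<tau>\<close>, the tree is finitely branching and, by
  Koenig's lemma, an infinite branch exists as soon as there are finite ones of every length. The latter is a
  measurable condition, and so is the leftmost infinite branch that is chosen here.\<close>

lemma suslin_bounded_branch: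
  fixes S :: "nat list \<Rightarrow> 'w set" and \<tau> :: "nat \<Rightarrow> nat"
  assumes S [measurable]: "\<And>p. S p \<in> sets M"
  defines "C \<equiv> {w \<in> space M. \<forall>n. \<exists>q. length q = n \<and> (\<forall>i<n. q ! i \<le> \<tau> i) \<and> (\<forall>k\<le>n. w \<in> S (take k q))}"
  obtains \<sigma> :: "'w \<Rightarrow> nat \<Rightarrow> nat" where
    "\<And>j. (\<lambda>w. \<sigma> w j) \<in> measurable M (count_space UNIV)"
    "\<And>w n. w \<in> C \<Longrightarrow> w \<in> S (map (\<sigma> w) [0..<n])"
proof -
  define B where "B n = {q :: nat list. length q = n \<and> (\<forall>i<n. q ! i \<le> \<tau> i)}" for n
  have fB: "finite (B n)" for n unfolding B_def by (rule finite_bounded_lists)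
  define Q where "Q w p \<longleftrightarrow> (\<forall>n\<ge>length p. \<exists>q\<in>B n. take (length p) q = p \<and> (\<forall>k\<in>{..n}. w \<in> S (take k q)))" for w p
  have Qm[measurable]: "Measurable.pred M (\<lambda>w. Q w p)" for p
  proof -
    have "Measurable.pred M (\<lambda>w. \<exists>q\<in>B n. take (length p) q = p \<and> (\<forall>k\<in>{..n}. w \<in> S (take k q)))" for n
      by (rule pred_intros_finite(4)[OF fB]) measurable
    then show ?thesis unfolding Q_def by measurable
  qed
  \<comment> \<open>Koenig's step: if every child died out, then beyond the maximal time of death no node would be left.\<close>
  have Qstep: "\<exists>i. Q w (p @ [i])" if Qp: "Q w p" for w p
  proof (rule ccontr)
    assume "\<nexists>i. Q w (p @ [i])"
    then have "\<forall>i. \<exists>n. n \<ge> Suc (length p) \<and> (\<forall>q\<in>B n. take (Suc (length p)) q = p @ [i] \<longrightarrow> \<not> (\<forall>k\<in>{..n}. w \<in> S (take k q)))"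
      unfolding Q_def by simp
    then obtain N where N: "\<And>i. N i \<ge> Suc (length p)"
      "\<And>i q. q \<in> B (N i) \<Longrightarrow> take (Suc (length p)) q = p @ [i] \<Longrightarrow> \<not> (\<forall>k\<in>{..N i}. w \<in> S (take k q))"
      by metis
    define m where "m = Max (N ` {..\<tau> (length p)})"
    have Nm: "N i \<le> m" if "i \<le> \<tau> (length p)" for i
      unfolding m_def using that by (intro Max_ge) auto
    have lm: "Suc (length p) \<le> m" using N(1)[of 0] Nm[of 0] by simp
    then obtain q where q: "q \<in> B m" "take (length p) q = p" "\<forall>k\<in>{..m}. w \<in> S (take k q)"
      using Qp unfolding Q_def by (meson Suc_leD)
    define i where "i = q ! length p"
    have lq: "length q = m" using q(1) by (simp add: B_def)
    have i: "i \<le> \<tau> (length p)" using q(1) lm unfolding i_def B_def by auto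
    have "take (N i) q \<in> B (N i)" using q(1) Nm[OF i] by (auto simp: B_def)
    moreover have "take (Suc (length p)) (take (N i) q) = p @ [i]"
      using q(2) N(1)[of i] lm lq unfolding i_def by (simp add: min_absorb1 take_Suc_conv_app_nth)
    ultimately have "\<not> (\<forall>k\<in>{..N i}. w \<in> S (take k (take (N i) q)))" by (rule N(2))
    then show False using q(3) Nm[OF i] by (auto simp: min_def split: if_splits)
  qed
  define g where "g = rec_nat (\<lambda>w. []) (\<lambda>n h w. h w @ [LEAST i. Q w (h w @ [i])])"
  define \<sigma> where "\<sigma> w n = (LEAST i. Q w (g n w @ [i]))" for w n
  have g0: "g 0 w = []" and gS: "g (Suc n) w = g n w @ [\<sigma> w n]" for n w
    by (simp_all add: g_def \<sigma>_def)
  have gm: "g n w = map (\<sigma> w) [0..<n]" for n w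
    by (induction n) (simp_all add: g0 gS)
  have lg: "length (g n w) = n" for n w by (simp add: gm)
  have meas: "g n \<in> measurable M (count_space UNIV) \<and> (\<lambda>w. \<sigma> w n) \<in> measurable M (count_space UNIV)" for n
  proof -
    have *: "(\<lambda>w. \<sigma> w n) \<in> measurable M (count_space UNIV)"
      if [measurable]: "g n \<in> measurable M (count_space UNIV)" for n
      unfolding \<sigma>_def
      by (rule measurable_compose_countable[where f="\<lambda>p w. LEAST i. Q w (p @ [i])", OF _ that]) measurable
    have "g n \<in> measurable M (count_space UNIV)" for n
    proof (induction n)
      case 0 then show ?case by (simp add: g_def)
    next
      case (Suc n)
      have "(\<lambda>w. g n w @ [\<sigma> w n]) \<in> measurable M (count_space UNIV)"
        by (rule measurable_compose_countable[where f="\<lambda>p w. p @ [\<sigma> w n]", OF _ Suc],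
            rule measurable_compose_countable[where f="\<lambda>i w. _ @ [i]", OF _ *[OF Suc]]) simp
      then show ?case by (simp add: gS[abs_def])
    qed
    then show ?thesis using * by blast
  qed
  show thesis
  proof (rule that)
    show "(\<lambda>w. \<sigma> w j) \<in> measurable M (count_space UNIV)" for j using meas by blast
    fix w n assume w: "w \<in> C"
    have Qg: "Q w (g n w)" for n
    proof (induction n)
      case 0
      have "\<exists>q\<in>B n. \<forall>k\<in>{..n}. w \<in> S (take k q)" for n
      proof -
        obtain q where "length q = n" "\<forall>i<n. q ! i \<le> \<tau> i" "\<forall>k\<le>n. w \<in> S (take k q)"
          using w unfolding C_def by blast
        then show ?thesis unfolding B_def by blast
      qed
      then show ?case by (simp add: Q_def g0)
    next
      case (Suc n)
      from LeastI_ex[OF Qstep[OF Suc]] show ?case by (simp only: gS \<sigma>_def)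
    qed
    have "\<exists>q\<in>B n. take n q = g n w \<and> (\<forall>k\<in>{..n}. w \<in> S (take k q))"
      using Qg[of n] unfolding Q_def lg by blast
    then obtain q where "take n q = g n w" "w \<in> S (take n q)" by blast
    then show "w \<in> S (map (\<sigma> w) [0..<n])" by (simp add: gm)
  qed
qed

text \<open>Choquet's argument. Outer measure is continuous along increasing sequences of arbitrary sets.
  Bounding the first coordinate of the branches, then the second, and so on, exhausts the Suslin set
  from below at each stage, so the bounds can be chosen one by one without the outer measure ever dropping to \<open>c\<close>.
  In the limit all coordinates are bounded, and the bounded branches sweep out a measurable set.\<close>

lemma suslin_capacitable:
  fixes S :: "nat list \<Rightarrow> 'w set"
  assumes "finite_measure M" and S [measurable]: "\<And>p. S p \<in> sets M"
    and c: "c < outer_measure_of M (suslin M S)"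
  obtains C \<sigma> where "C \<in> sets M" "c \<le> emeasure M C"
    "\<And>j. (\<lambda>w. \<sigma> w j) \<in> measurable M (count_space UNIV)"
    "\<And>w n. w \<in> C \<Longrightarrow> w \<in> S (map (\<sigma> w) [0..<n])"
proof -
  interpret finite_measure M by fact
  define D where "D t = {w \<in> space M. \<exists>\<sigma>. (\<forall>j<length t. \<sigma> j \<le> t ! j) \<and> (\<forall>n. w \<in> S (map \<sigma> [0..<n]))}" for t
  have "\<exists>i. c < outer_measure_of M (D (t @ [i]))" if "c < outer_measure_of M (D t)" for t
  proof -
    have inc: "incseq (\<lambda>i. D (t @ [i]))"
    proof (rule incseq_SucI, rule subsetI)
      fix i w assume "w \<in> D (t @ [i])"
      then obtain \<sigma> where "w \<in> space M" "\<forall>j<length (t @ [i]). \<sigma> j \<le> (t @ [i]) ! j" "\<forall>n. w \<in> S (map \<sigma> [0..<n])"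
        by (auto simp: D_def)
      moreover from this(2) have "\<forall>j<length (t @ [Suc i]). \<sigma> j \<le> (t @ [Suc i]) ! j"
        by (force simp: nth_append less_Suc_eq)
      ultimately show "w \<in> D (t @ [Suc i])" unfolding D_def by blast
    qed
    have "D t \<subseteq> (\<Union>i. D (t @ [i]))"
    proof
      fix w assume "w \<in> D t"
      then obtain \<sigma> where "w \<in> space M" "\<forall>j<length t. \<sigma> j \<le> t ! j" "\<forall>n. w \<in> S (map \<sigma> [0..<n])"
        by (auto simp: D_def)
      moreover from this(2) have "\<forall>j<length (t @ [\<sigma> (length t)]). \<sigma> j \<le> (t @ [\<sigma> (length t)]) ! j"
        by (auto simp: nth_append less_Suc_eq)
      ultimately have "w \<in> D (t @ [\<sigma> (length t)])" unfolding D_def by blast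
      then show "w \<in> (\<Union>i. D (t @ [i]))" by blast
    qed
    then have "c < outer_measure_of M (\<Union>i. D (t @ [i]))"
      using that outer_measure_of_mono less_le_trans by blast
    also have "\<dots> = (SUP i. outer_measure_of M (D (t @ [i])))"
      using inc by (subst SUP_outer_measure_of_incseq) (auto simp: D_def)
    finally show ?thesis by (auto simp: less_SUP_iff)
  qed
  moreover have "c < outer_measure_of M (D [])"
    using c by (simp add: D_def suslin_def)
  ultimately obtain \<tau> where \<tau>: "\<And>n. c < outer_measure_of M (D (map \<tau> [0..<n]))"
    using dependent_list_choice[of "\<lambda>t. c < outer_measure_of M (D t)"] by blast
  define B where "B n = {q :: nat list. length q = n \<and> (\<forall>i<n. q ! i \<le> \<tau> i)}" for n
  have fB: "finite (B n)" for n unfolding B_def by (rule finite_bounded_lists)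
  define K where "K n = {w \<in> space M. \<exists>q\<in>B n. \<forall>k\<in>{..n}. w \<in> S (take k q)}" for n
  have Km[measurable]: "K n \<in> sets M" for n
  proof -
    have "Measurable.pred M (\<lambda>w. \<exists>q\<in>B n. \<forall>k\<in>{..n}. w \<in> S (take k q))"
      by (rule pred_intros_finite(4)[OF fB]) measurable
    then show ?thesis unfolding K_def by measurable
  qed
  have Kdec: "decseq K"
  proof (rule decseq_SucI, rule subsetI)
    fix n w assume "w \<in> K (Suc n)"
    then obtain q where q: "w \<in> space M" "q \<in> B (Suc n)" "\<forall>k\<in>{..Suc n}. w \<in> S (take k q)" by (auto simp: K_def)
    have "take n q \<in> B n" using q(2) by (auto simp: B_def)
    moreover have "\<forall>k\<in>{..n}. w \<in> S (take k (take n q))" using q(3) by (auto simp: min_def)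
    ultimately show "w \<in> K n" using q(1) unfolding K_def by blast
  qed
  have DK: "D (map \<tau> [0..<n]) \<subseteq> K n" for n
  proof
    fix w assume "w \<in> D (map \<tau> [0..<n])"
    then obtain \<sigma> where s: "w \<in> space M" "\<forall>j<n. \<sigma> j \<le> \<tau> j" "\<forall>n. w \<in> S (map \<sigma> [0..<n])"
      by (auto simp: D_def)
    have "map \<sigma> [0..<n] \<in> B n" using s(2) by (simp add: B_def)
    moreover have "\<forall>k\<in>{..n}. w \<in> S (take k (map \<sigma> [0..<n]))"
      using s(3) by (simp add: take_map)
    ultimately show "w \<in> K n" using s(1) unfolding K_def by blast
  qed
  \<comment> \<open>the measurable set \<open>K n\<close> covers the points with a branch bounded up to \<open>n\<close>, a set of outer measure above \<open>c\<close>\<close>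
  have "c \<le> emeasure M (K n)" for n
    using less_le_trans[OF \<tau> outer_measure_of_mono[OF DK[of n]]] by simp
  moreover have "(INF n. emeasure M (K n)) = emeasure M (\<Inter>n. K n)"
    using Kdec by (intro INF_emeasure_decseq) auto
  ultimately have cK: "c \<le> emeasure M (\<Inter>n. K n)"
    by (metis INF_greatest)
  have KM: "(\<Inter>n. K n) \<in> sets M"
    using Km by (intro sets.countable_INT) auto
  obtain \<sigma> where \<sigma>: "\<And>j. (\<lambda>w. \<sigma> w j) \<in> measurable M (count_space UNIV)"
    "\<And>w n. w \<in> {w \<in> space M. \<forall>n. \<exists>q. length q = n \<and> (\<forall>i<n. q ! i \<le> \<tau> i) \<and> (\<forall>k\<le>n. w \<in> S (take k q))}
       \<Longrightarrow> w \<in> S (map (\<sigma> w) [0..<n])"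
    using suslin_bounded_branch[of S M \<tau>, OF S] by blast
  show thesis
  proof (rule that[OF KM cK \<sigma>(1)])
    fix w n assume "w \<in> (\<Inter>n. K n)"
    then have w: "w \<in> K n" for n by blast
    have "\<exists>q. length q = n \<and> (\<forall>i<n. q ! i \<le> \<tau> i) \<and> (\<forall>k\<le>n. w \<in> S (take k q))" for n
      using w[of n] unfolding K_def B_def by auto
    then show "w \<in> S (map (\<sigma> w) [0..<n])"
      by (intro \<sigma>(2)) (use w[of 0] in \<open>simp add: K_def\<close>)
  qed
qed

text \<open>Exhausting a measurable hull \<open>H\<close> by inner approximations shows that Suslin sets are measurable up to
  null sets, with a measurable choice of a branch on the inner set.\<close>

theorem suslin_uniformization:
  fixes S :: "nat list \<Rightarrow> 'w set"
  assumes fin: "finite_measure M" and S: "\<And>p. S p \<in> sets M"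
  obtains C H \<sigma> where "C \<in> sets M" "H \<in> sets M" "suslin M S \<subseteq> H" "emeasure M (H - C) = 0"
    "\<And>j. (\<lambda>w. \<sigma> w j) \<in> measurable M (count_space UNIV)"
    "\<And>w n. w \<in> C \<Longrightarrow> w \<in> S (map (\<sigma> w) [0..<n])"
proof -
  interpret finite_measure M by fact
  obtain H where H[measurable]: "H \<in> sets M" and sub: "suslin M S \<subseteq> H"
    and out: "outer_measure_of M (suslin M S) = emeasure M H"
    using outer_measure_of_attain[OF suslin_subset_space[of M S]] by blast
  show thesis
  proof (cases "measure M H = 0")
    case True
    show thesis
    proof (rule that[where \<sigma>="\<lambda>_ _. 0"])
      show "emeasure M (H - {}) = 0" using True by (simp add: emeasure_eq_measure)
    qed (use H sub in auto)
  next
    case False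
    define a where "a = measure M H"
    have a: "a > 0" using False measure_nonneg[of M H] unfolding a_def by linarith
    have "\<exists>C \<sigma>. C \<in> sets M \<and> ennreal (a - a / (real k + 2)) \<le> emeasure M C \<and>
       (\<forall>j. (\<lambda>w. \<sigma> w j) \<in> measurable M (count_space UNIV)) \<and>
       (\<forall>w n. w \<in> C \<longrightarrow> w \<in> S (map (\<sigma> w) [0..<n]))" for k :: nat
    proof -
      have "ennreal (a - a / (real k + 2)) < outer_measure_of M (suslin M S)"
        using a unfolding out emeasure_eq_measure a_def[symmetric] by (intro ennreal_lessI) auto
      from suslin_capacitable[OF fin S this] show ?thesis by metis
    qed
    then obtain C \<sigma> where C[measurable]: "\<And>k::nat. C k \<in> sets M"
      and Cm: "\<And>k::nat. ennreal (a - a / (real k + 2)) \<le> emeasure M (C k)"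
      and \<sigma>[measurable]: "\<And>k j. (\<lambda>w. \<sigma> k w j) \<in> measurable M (count_space UNIV)"
      and CS: "\<And>k w n. w \<in> C k \<Longrightarrow> w \<in> S (map (\<sigma> k w) [0..<n])"
      by metis
    have CM: "(\<Union>k. C k) \<in> sets M" by measurable
    have CH: "C k \<subseteq> H" for k
    proof
      fix w assume w: "w \<in> C k"
      have "w \<in> suslin M S"
        using CS[OF w] sets.sets_into_space[OF C] w unfolding suslin_def by blast
      then show "w \<in> H" using sub by blast
    qed
    have "measure M (H - (\<Union>k. C k)) \<le> a / (real k + 2)" for k :: nat
    proof -
      have "measure M (H - (\<Union>k. C k)) \<le> measure M (H - C k)" by (rule finite_measure_mono) auto
      also have "\<dots> = a - measure M (C k)" unfolding a_def using CH by (intro finite_measure_Diff) auto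
      also have "\<dots> \<le> a / (real k + 2)"
        using Cm[of k] by (simp add: emeasure_eq_measure measure_nonneg)
      finally show ?thesis .
    qed
    moreover have "(\<lambda>k. a / (real k + 2)) \<longlonglongrightarrow> 0" by real_asymp
    ultimately have "measure M (H - (\<Union>k. C k)) \<le> 0"
      by (intro LIMSEQ_le_const) auto
    then have null: "emeasure M (H - (\<Union>k. C k)) = 0"
      unfolding emeasure_eq_measure by (rule ennreal_neg)
    define \<rho> where "\<rho> w = \<sigma> (LEAST k. w \<in> C k) w" for w
    have L: "(\<lambda>w. LEAST k. w \<in> C k) \<in> measurable M (count_space UNIV)"
      by measurable
    have \<rho>m: "(\<lambda>w. \<rho> w j) \<in> measurable M (count_space UNIV)" for j
      unfolding \<rho>_def
      using measurable_compose_countable[where f="\<lambda>k w. \<sigma> k w j", OF \<sigma> L] .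
    have \<rho>S: "w \<in> S (map (\<rho> w) [0..<n])" if w: "w \<in> (\<Union>k. C k)" for w n
    proof -
      have "\<exists>k. w \<in> C k" using w by blast
      then have "w \<in> C (LEAST k. w \<in> C k)" by (rule LeastI_ex)
      then show ?thesis unfolding \<rho>_def by (rule CS)
    qed
    show thesis using that[OF CM H sub null \<rho>m \<rho>S] .
  qed
qed

section \<open>Projections along compact sets\<close>

text \<open>Projections of measurable sets need not be measurable, but those along a compact set with continuous
  sections are: the condition at a point of \<open>F\<close> may be tested approximately and for finitely many indices on a
  countable dense subset, and compactness turns approximate solutions into an exact one.\<close>

lemma sets_compact_projection:
  fixes g :: "'i::countable \<Rightarrow> 'w \<Rightarrow> 'z::{metric_space, second_countable_topology} \<Rightarrow> real"
  assumes F: "compact F"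
    and g [measurable]: "\<And>i z. (\<lambda>w. g i w z) \<in> borel_measurable M"
    and cont: "\<And>i w. w \<in> space M \<Longrightarrow> continuous_on F (g i w)"
  shows "{w \<in> space M. \<exists>z\<in>F. \<forall>i. g i w z \<le> 0} \<in> sets M"
proof -
  obtain D where D: "countable D" "D \<subseteq> F" "F \<subseteq> closure D"
    using separable[of F] by blast
  define h where "h k = g (from_nat k)" for k
  have hm [measurable]: "(\<lambda>w. h k w z) \<in> borel_measurable M" for k z
    unfolding h_def by measurable
  have hc: "continuous_on F (h k w)" if "w \<in> space M" for k w
    unfolding h_def using that by (rule cont)
  have "(\<exists>z\<in>F. \<forall>i. g i w z \<le> 0) \<longleftrightarrow> (\<forall>n. \<exists>z\<in>D. \<forall>k<n. h k w z < 1 / (real n + 1))"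
    if w: "w \<in> space M" for w
  proof
    assume "\<exists>z\<in>F. \<forall>i. g i w z \<le> 0"
    then obtain z where z: "z \<in> F" "\<And>i. g i w z \<le> 0" by blast
    show "\<forall>n. \<exists>z\<in>D. \<forall>k<n. h k w z < 1 / (real n + 1)"
    proof
      fix n
      have "z \<in> closure D" using z(1) D(3) by blast
      then obtain s where s: "\<And>m. s m \<in> D" "s \<longlonglongrightarrow> z" by (auto simp: closure_sequential)
      have "\<forall>\<^sub>F m in sequentially. h k w (s m) < 1 / (real n + 1)" for k
      proof -
        have "(\<lambda>m. h k w (s m)) \<longlonglongrightarrow> h k w z"
          by (rule continuous_on_tendsto_compose[OF hc[OF w] s(2) z(1)])
              (use s(1) D(2) in \<open>simp add: subset_iff\<close>)
        moreover have "h k w z < 1 / (real n + 1)"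
          using z(2)[of "from_nat k"] by (simp add: h_def le_less_trans)
        ultimately show ?thesis by (rule order_tendstoD(2))
      qed
      then have "\<forall>\<^sub>F m in sequentially. \<forall>k\<in>{..<n}. h k w (s m) < 1 / (real n + 1)"
        by (simp add: eventually_ball_finite)
      then obtain m where "\<forall>k\<in>{..<n}. h k w (s m) < 1 / (real n + 1)"
        by (auto simp: eventually_sequentially)
      then show "\<exists>z\<in>D. \<forall>k<n. h k w z < 1 / (real n + 1)" using s(1) by auto
    qed
  next
    assume "\<forall>n. \<exists>z\<in>D. \<forall>k<n. h k w z < 1 / (real n + 1)"
    then have "\<forall>n. \<exists>z. z \<in> D \<and> (\<forall>k<n. h k w z < 1 / (real n + 1))" by blast
    from choice[OF this] obtain s where
      s: "\<And>n. s n \<in> D" "\<And>n k. k < n \<Longrightarrow> h k w (s n) < 1 / (real n + 1)" by blast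
    have "\<forall>n. s n \<in> F" using s(1) D(2) by blast
    then obtain z r where z: "z \<in> F" and r: "strict_mono r" "(s \<circ> r) \<longlonglongrightarrow> z"
      using seq_compactE[OF F[unfolded compact_eq_seq_compact_metric]] by blast
    have "g i w z \<le> 0" for i
    proof -
      define k where "k = to_nat i"
      have "(\<lambda>m. h k w ((s \<circ> r) m)) \<longlonglongrightarrow> h k w z"
        by (rule continuous_on_tendsto_compose[OF hc[OF w] r(2) z]) (use \<open>\<forall>n. s n \<in> F\<close> in auto)
      moreover have "(\<lambda>m. 1 / (real m + 1)) \<longlonglongrightarrow> 0" by real_asymp
      moreover have "\<exists>N. \<forall>m\<ge>N. h k w ((s \<circ> r) m) \<le> 1 / (real m + 1)"
      proof (intro exI allI impI)
        fix m assume m: "m \<ge> Suc k"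
        have rm: "m \<le> r m" using r(1) by (rule seq_suble)
        then have "h k w (s (r m)) < 1 / (real (r m) + 1)" using m by (intro s(2)) simp
        also have "\<dots> \<le> 1 / (real m + 1)" using rm by (intro divide_left_mono) auto
        finally show "h k w ((s \<circ> r) m) \<le> 1 / (real m + 1)" by simp
      qed
      ultimately have "h k w z \<le> 0" by (rule LIMSEQ_le)
      then show ?thesis by (simp add: h_def k_def)
    qed
    then show "\<exists>z\<in>F. \<forall>i. g i w z \<le> 0" using z by blast
  qed
  then have "{w \<in> space M. \<exists>z\<in>F. \<forall>i. g i w z \<le> 0}
      = {w \<in> space M. \<forall>n. \<exists>z\<in>D. \<forall>k<n. h k w z < 1 / (real n + 1)}"
    by blast
  also have "\<dots> \<in> sets M"
  proof -
    have "{w \<in> space M. \<exists>z\<in>D. \<forall>k<n. h k w z < 1 / (real n + 1)} \<in> sets M" for n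
      by (rule sets.sets_Collect_countable_Ex'[OF _ D(1)]) measurable
    then show ?thesis by (rule sets.sets_Collect_countable_All)
  qed
  finally show ?thesis .
qed

section \<open>Condensation points and dyadic intervals\<close>

text \<open>The points of \<open>\<Gamma>\<close> that are not condensation points lie in countably many basic open sets, each of
  which meets \<open>\<Gamma>\<close> in a countable set. Hence they are countably many, and \<open>U\<close> keeps uncountably many others.\<close>

lemma condensation_points:
  fixes \<Gamma> :: "'x::second_countable_topology set"
  defines "Q \<equiv> {y \<in> \<Gamma>. \<forall>U. open U \<longrightarrow> y \<in> U \<longrightarrow> uncountable (\<Gamma> \<inter> U)}"
  assumes U: "uncountable (\<Gamma> \<inter> U)"
  shows "infinite (Q \<inter> U)"
proof
  assume fin: "finite (Q \<inter> U)"
  obtain B :: "'x set set" where B: "countable B" "topological_basis B"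
    using ex_countable_basis by blast
  have "\<Gamma> - Q \<subseteq> (\<Union>b\<in>{b\<in>B. countable (\<Gamma> \<inter> b)}. \<Gamma> \<inter> b)"
  proof
    fix y assume y: "y \<in> \<Gamma> - Q"
    then obtain V where V: "open V" "y \<in> V" "countable (\<Gamma> \<inter> V)" by (auto simp: Q_def)
    obtain b where b: "b \<in> B" "y \<in> b" "b \<subseteq> V"
      by (rule topological_basisE[OF B(2) V(1,2)])
    have "\<Gamma> \<inter> b \<subseteq> \<Gamma> \<inter> V" using b(3) by blast
    then have "countable (\<Gamma> \<inter> b)" using V(3) by (rule countable_subset)
    then show "y \<in> (\<Union>b\<in>{b\<in>B. countable (\<Gamma> \<inter> b)}. \<Gamma> \<inter> b)" using b y by blast
  qed
  moreover have "countable (\<Union>b\<in>{b\<in>B. countable (\<Gamma> \<inter> b)}. \<Gamma> \<inter> b)"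
    using B(1) by (intro countable_UN) auto
  ultimately have "countable (\<Gamma> - Q)" by (rule countable_subset)
  then have "countable ((\<Gamma> - Q) \<union> (Q \<inter> U))" using fin by (simp add: countable_finite)
  then have "countable (\<Gamma> \<inter> U)" by (rule countable_subset[rotated]) auto
  then show False using U by blast
qed

lemma distinct_representatives_infinite:
  fixes A :: "nat \<Rightarrow> 'a set"
  assumes "\<And>s. s < N \<Longrightarrow> infinite (A s)"
  shows "\<exists>y. inj_on y {..<N} \<and> (\<forall>s<N. y s \<in> A s)"
  using assms
proof (induction N)
  case 0 then show ?case by simp
next
  case (Suc N)
  then obtain y where y: "inj_on y {..<N}" "\<And>s. s < N \<Longrightarrow> y s \<in> A s" by auto
  have "infinite (A N - y ` {..<N})" using Suc.prems[of N] by simp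
  then obtain v where v: "v \<in> A N" "v \<notin> y ` {..<N}"
    using infinite_imp_nonempty by blast
  have "inj_on (y(N := v)) {..<Suc N}"
    using y(1) v(2) by (auto simp: inj_on_def less_Suc_eq)
  moreover have "\<forall>s<Suc N. (y(N := v)) s \<in> A s"
    using y(2) v(1) by (auto simp: less_Suc_eq)
  ultimately show ?case by blast
qed

lemma finite_set_separated:
  fixes y :: "nat \<Rightarrow> 'x::metric_space"
  assumes "inj_on y {..<N}"
  shows "\<exists>\<eta>>0. \<forall>s<N. \<forall>s'<N. s \<noteq> s' \<longrightarrow> \<eta> < dist (y s) (y s')"
proof -
  define T where "T = (\<lambda>(s, s'). dist (y s) (y s')) ` {(s, s') \<in> {..<N} \<times> {..<N}. s \<noteq> s'}"
  have "finite {(s, s') \<in> {..<N} \<times> {..<N}. s \<noteq> s'}"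
    by (rule finite_subset[of _ "{..<N} \<times> {..<N}"]) auto
  then have T: "finite (insert 1 T)" unfolding T_def by simp
  have pos: "v > 0" if "v \<in> insert 1 T" for v
    using that assms by (auto simp: T_def inj_on_def)
  define \<eta> where "\<eta> = Min (insert 1 T) / 2"
  have M: "Min (insert 1 T) > 0" using pos Min_in[OF T] by blast
  have "\<eta> < dist (y s) (y s')" if "s < N" "s' < N" "s \<noteq> s'" for s s'
  proof -
    have "dist (y s) (y s') \<in> insert 1 T" using that by (auto simp: T_def)
    then have "Min (insert 1 T) \<le> dist (y s) (y s')" using T by (rule Min_le[rotated])
    then show ?thesis using M by (simp add: \<eta>_def)
  qed
  moreover have "\<eta> > 0" using M by (simp add: \<eta>_def)
  ultimately show ?thesis by blast
qed

lemma dyadic_floor_separates: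
  fixes t t' :: real
  assumes "t \<noteq> t'" "0 \<le> t" "0 \<le> t'"
  shows "\<exists>j. nat \<lfloor>t * 2 ^ j\<rfloor> \<noteq> nat \<lfloor>t' * 2 ^ j\<rfloor>"
proof (rule ccontr)
  assume "\<not> ?thesis"
  then have eq: "nat \<lfloor>t * 2 ^ j\<rfloor> = nat \<lfloor>t' * 2 ^ j\<rfloor>" for j by blast
  obtain j where "1 / \<bar>t - t'\<bar> < 2 ^ j"
    using real_arch_pow[of 2 "1 / \<bar>t - t'\<bar>"] by auto
  then have "1 < \<bar>t - t'\<bar> * 2 ^ j" using assms(1) by (simp add: field_simps)
  also have "\<dots> = \<bar>(t - t') * 2 ^ j\<bar>" by (simp add: abs_mult)
  also have "\<dots> = \<bar>t * 2 ^ j - t' * 2 ^ j\<bar>" by (simp only: left_diff_distrib)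
  finally have big: "1 < \<bar>t * 2 ^ j - t' * 2 ^ j\<bar>" .
  have "\<lfloor>t * 2 ^ j\<rfloor> = \<lfloor>t' * 2 ^ j\<rfloor>"
    using eq[of j] assms by (subst (asm) eq_nat_nat_iff) auto
  then show False using big by linarith
qed

lemma dyadic_floor_div:
  fixes t :: real
  assumes "0 \<le> t" "j \<le> n"
  shows "nat \<lfloor>t * 2 ^ n\<rfloor> div 2 ^ (n - j) = nat \<lfloor>t * 2 ^ j\<rfloor>"
proof -
  have "t * 2 ^ j = t * 2 ^ n / real_of_int (2 ^ (n - j))"
    using assms(2) by (simp add: field_simps flip: power_add)
  then have "\<lfloor>t * 2 ^ j\<rfloor> = \<lfloor>t * 2 ^ n\<rfloor> div 2 ^ (n - j)"
    by (simp add: floor_divide_real_eq_div del: of_int_power)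
  then show ?thesis
    using assms(1) by (simp add: nat_div_distrib nat_power_eq)
qed

section \<open>Codes of Cantor schemes\<close>

text \<open>A natural number \<open>e\<close> codes one level of a Cantor scheme: the index of an approximation to
  the base point \<open>x\<close> of the section, a scale \<open>l\<close> which stands for the radius \<open>1 / (l + 1)\<close>, and the list of
  indices of the centres of the balls at that level. Indices refer to a dense sequence \<open>d\<close>.\<close>

abbreviation base_index :: "nat \<Rightarrow> nat" where
  "base_index e \<equiv> fst (from_nat e :: nat \<times> nat \<times> nat list)"

abbreviation scale :: "nat \<Rightarrow> nat" where
  "scale e \<equiv> fst (snd (from_nat e :: nat \<times> nat \<times> nat list))"

abbreviation center_index :: "nat \<Rightarrow> nat \<Rightarrow> nat" where
  "center_index e s \<equiv> snd (snd (from_nat e :: nat \<times> nat \<times> nat list)) ! s"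

text \<open>Level \<open>j\<close> has \<open>2 ^ j\<close> balls. Centres further apart than twice the radius make them disjoint, which is
  what yields injectivity. The scale is at least \<open>j\<close>, so that the radii tend to zero.\<close>

definition separated_codes :: "(nat \<Rightarrow> 'x::metric_space) \<Rightarrow> nat list \<Rightarrow> bool" where
  "separated_codes d p \<longleftrightarrow> (\<forall>j<length p. j \<le> scale (p ! j) \<and>
     (\<forall>s<2 ^ j. \<forall>s'<2 ^ j. s \<noteq> s' \<longrightarrow>
        2 / (real (scale (p ! j)) + 1) < dist (d (center_index (p ! j) s)) (d (center_index (p ! j) s'))))"

text \<open>The cell with index \<open>s < 2 ^ length p\<close> at the bottom of the scheme lies, at level \<open>j\<close>, in the ball of its ancestor
  \<open>s div 2 ^ (length p - j)\<close>. The balls of different levels are not nested; the cell is their intersection.\<close>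

definition code_box :: "(nat \<Rightarrow> 'x::metric_space) \<Rightarrow> nat list \<Rightarrow> nat \<Rightarrow> ('x \<times> 'x) set" where
  "code_box d p s = {(x, y). \<forall>j<length p. dist x (d (base_index (p ! j))) \<le> 1 / (real j + 1) \<and>
     dist y (d (center_index (p ! j) (s div 2 ^ (length p - j)))) \<le> 1 / (real (scale (p ! j)) + 1)}"

definition cantor_scheme :: "(nat \<Rightarrow> 'x::metric_space) \<Rightarrow> 'w measure \<Rightarrow> ('w \<Rightarrow> ('x \<times> 'x) set) \<Rightarrow> nat list \<Rightarrow> 'w set" where
  "cantor_scheme d M E p =
     {w \<in> space M. separated_codes d p \<and> (\<forall>s<2 ^ length p. E w \<inter> code_box d p s \<noteq> {})}"

lemma closed_code_box: "closed (code_box d p s)"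
  unfolding code_box_def case_prod_beta
  by (intro closed_Collect_all closed_Collect_imp open_Collect_const closed_Collect_conj
      closed_Collect_le continuous_intros)

lemma sets_cantor_scheme:
  assumes "\<And>F. closed F \<Longrightarrow> {w \<in> space M. E w \<inter> F \<noteq> {}} \<in> sets M"
  shows "cantor_scheme d M E p \<in> sets M"
proof -
  have "cantor_scheme d M E p = (if separated_codes d p then
      space M \<inter> (\<Inter>s\<in>{..<2 ^ length p}. {w \<in> space M. E w \<inter> code_box d p s \<noteq> {}}) else {})"
    by (auto simp: cantor_scheme_def)
  also have "\<dots> \<in> sets M"
    using assms[OF closed_code_box[of d p]] by (auto intro!: sets.Int sets.finite_INT)
  finally show ?thesis .
qed

lemma scale_tendsto_zero: "(\<lambda>n. 1 / (real n + 1)) \<longlonglongrightarrow> 0"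
  by real_asymp

text \<open>Compatible finite approximations suffice: no single point is known yet to be close to all \<open>q j\<close>.\<close>

lemma Cauchy_if_simultaneously_close:
  fixes q :: "nat \<Rightarrow> 'x::metric_space" and z :: "nat \<Rightarrow> 'x"
  assumes "\<And>j n. j < n \<Longrightarrow> dist (z n) (q j) \<le> 1 / (real j + 1)"
  shows "Cauchy q"
proof (rule metric_CauchyI)
  fix e :: real assume e: "e > 0"
  obtain N where N: "1 / (real N + 1) < e / 2"
    using order_tendstoD(2)[OF scale_tendsto_zero, of "e / 2"] e
    by (auto simp: eventually_sequentially)
  have "dist (q i) (q j) < e" if "N \<le> i" "N \<le> j" for i j
  proof -
    define n where "n = Suc (max i j)"
    have "dist (z n) (q i) \<le> 1 / (real i + 1)" "dist (z n) (q j) \<le> 1 / (real j + 1)"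
      by (rule assms; simp add: n_def)+
    moreover have "1 / (real i + 1) \<le> 1 / (real N + 1)" "1 / (real j + 1) \<le> 1 / (real N + 1)"
      using that by (auto intro!: divide_left_mono)
    moreover have "dist (q i) (q j) \<le> dist (z n) (q i) + dist (z n) (q j)"
      by (rule dist_triangle3)
    ultimately show ?thesis using N by linarith
  qed
  then show "\<exists>N. \<forall>i\<ge>N. \<forall>j\<ge>N. dist (q i) (q j) < e" by blast
qed

lemma tendsto_of_close:
  fixes f g :: "nat \<Rightarrow> 'x::metric_space"
  assumes "f \<longlonglongrightarrow> a" "(\<lambda>n. dist (f n) (g n)) \<longlonglongrightarrow> 0"
  shows "g \<longlonglongrightarrow> a"
proof -
  have lim: "(\<lambda>n. dist (f n) (g n) + dist (f n) a) \<longlonglongrightarrow> 0"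
    using tendsto_add[OF assms(2) tendsto_dist[OF assms(1) tendsto_const[of a]]] by simp
  have le: "\<forall>\<^sub>F n in sequentially. dist (g n) a \<le> dist (f n) (g n) + dist (f n) a"
    by (rule always_eventually) (rule allI, rule dist_triangle3)
  have "(\<lambda>n. dist (g n) a) \<longlonglongrightarrow> 0"
    by (rule tendsto_sandwich[OF _ le tendsto_const lim]) simp
  then show ?thesis by (rule tendsto_dist_iff[THEN iffD2])
qed

text \<open>A branch of the scheme determines a point for every \<open>t\<close> of the unit interval, by following the
  dyadic intervals that contain \<open>t\<close>. Points of \<open>E w\<close> in the cells along \<open>t\<close> converge to it, so it lies in the closed
  section over the common base point.\<close>

lemma cantor_branch_point:
  fixes d :: "nat \<Rightarrow> 'x::complete_space" and \<sigma> :: "nat \<Rightarrow> nat"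
  defines "q \<equiv> \<lambda>n t. d (center_index (\<sigma> n) (nat \<lfloor>t * 2 ^ n\<rfloor>))"
  assumes closed: "closed (E w)" and branch: "\<And>n. w \<in> cantor_scheme d M E (map \<sigma> [0..<n])"
    and t: "0 \<le> t" "t < (1::real)"
  shows "convergent (\<lambda>n. q n t)"
    and "(lim (\<lambda>n. d (base_index (\<sigma> n))), lim (\<lambda>n. q n t)) \<in> E w"
    and "dist (lim (\<lambda>n. q n t)) (q j t) \<le> 1 / (real (scale (\<sigma> j)) + 1)"
proof -
  have sc: "j \<le> scale (\<sigma> j)" for j
    using branch[of "Suc j"] by (auto simp: cantor_scheme_def separated_codes_def simp del: upt_Suc)
  have "\<exists>z. z \<in> E w \<inter> code_box d (map \<sigma> [0..<n]) (nat \<lfloor>t * 2 ^ n\<rfloor>)" for n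
  proof -
    have "t * 2 ^ n < 2 ^ n" using t by simp
    then have "\<lfloor>t * 2 ^ n\<rfloor> < 2 ^ n" by (simp add: floor_less_iff)
    then have "nat \<lfloor>t * 2 ^ n\<rfloor> < 2 ^ n" using t by (simp add: nat_less_iff)
    moreover have "\<forall>s<2 ^ n. E w \<inter> code_box d (map \<sigma> [0..<n]) s \<noteq> {}"
      using branch[of n] by (simp add: cantor_scheme_def)
    ultimately show ?thesis by blast
  qed
  then obtain z where z: "\<And>n. z n \<in> E w" "\<And>n. z n \<in> code_box d (map \<sigma> [0..<n]) (nat \<lfloor>t * 2 ^ n\<rfloor>)"
    by (metis IntE)
  have zx: "dist (fst (z n)) (d (base_index (\<sigma> j))) \<le> 1 / (real j + 1)" if "j < n" for j n
    using z(2)[of n] that by (auto simp: code_box_def case_prod_beta)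
  have zy: "dist (snd (z n)) (q j t) \<le> 1 / (real (scale (\<sigma> j)) + 1)" if "j < n" for j n
    using z(2)[of n] that t(1) by (auto simp: code_box_def case_prod_beta q_def dyadic_floor_div)
  have zy': "dist (snd (z n)) (q j t) \<le> 1 / (real j + 1)" if "j < n" for j n
  proof -
    have "1 / (real (scale (\<sigma> j)) + 1) \<le> 1 / (real j + 1)"
      using sc[of j] by (intro divide_left_mono) auto
    then show ?thesis using zy[OF that] by linarith
  qed
  have cx: "convergent (\<lambda>n. d (base_index (\<sigma> n)))"
    by (rule Cauchy_convergent, rule Cauchy_if_simultaneously_close) (rule zx)
  show cy: "convergent (\<lambda>n. q n t)"
    by (rule Cauchy_convergent, rule Cauchy_if_simultaneously_close) (rule zy')
  have lx: "(\<lambda>n. d (base_index (\<sigma> n))) \<longlonglongrightarrow> lim (\<lambda>n. d (base_index (\<sigma> n)))"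
    and ly: "(\<lambda>n. q n t) \<longlonglongrightarrow> lim (\<lambda>n. q n t)"
    using cx cy by (simp_all add: convergent_LIMSEQ_iff)
  have zlx: "(\<lambda>n. fst (z (Suc n))) \<longlonglongrightarrow> lim (\<lambda>n. d (base_index (\<sigma> n)))"
  proof (rule tendsto_of_close[OF lx])
    show "(\<lambda>n. dist (d (base_index (\<sigma> n))) (fst (z (Suc n)))) \<longlonglongrightarrow> 0"
    proof (rule tendsto_sandwich[OF _ _ tendsto_const scale_tendsto_zero])
      show "\<forall>\<^sub>F n in sequentially. dist (d (base_index (\<sigma> n))) (fst (z (Suc n))) \<le> 1 / (real n + 1)"
        by (rule always_eventually, rule allI, subst dist_commute) (rule zx, simp)
    qed simp
  qed
  have zly: "(\<lambda>n. snd (z (Suc n))) \<longlonglongrightarrow> lim (\<lambda>n. q n t)"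
  proof (rule tendsto_of_close[OF ly])
    show "(\<lambda>n. dist (q n t) (snd (z (Suc n)))) \<longlonglongrightarrow> 0"
    proof (rule tendsto_sandwich[OF _ _ tendsto_const scale_tendsto_zero])
      show "\<forall>\<^sub>F n in sequentially. dist (q n t) (snd (z (Suc n))) \<le> 1 / (real n + 1)"
        by (rule always_eventually, rule allI, subst dist_commute) (rule zy', simp)
    qed simp
  qed
  have "(\<lambda>n. (fst (z (Suc n)), snd (z (Suc n)))) \<longlonglongrightarrow> (lim (\<lambda>n. d (base_index (\<sigma> n))), lim (\<lambda>n. q n t))"
    by (rule tendsto_Pair[OF zlx zly])
  then show "(lim (\<lambda>n. d (base_index (\<sigma> n))), lim (\<lambda>n. q n t)) \<in> E w"
    by (rule closed_sequentially[OF closed, rotated]) (simp add: z(1))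
  show "dist (lim (\<lambda>n. q n t)) (q j t) \<le> 1 / (real (scale (\<sigma> j)) + 1)"
  proof (rule LIMSEQ_le_const2)
    show "(\<lambda>n. dist (snd (z (Suc n))) (q j t)) \<longlonglongrightarrow> dist (lim (\<lambda>n. q n t)) (q j t)"
      by (intro tendsto_intros zly)
    show "\<exists>N. \<forall>n\<ge>N. dist (snd (z (Suc n))) (q j t) \<le> 1 / (real (scale (\<sigma> j)) + 1)"
      by (rule exI[of _ j]) (simp add: zy)
  qed
qed

lemma cantor_branch_inj:
  fixes d :: "nat \<Rightarrow> 'x::complete_space" and \<sigma> :: "nat \<Rightarrow> nat"
  assumes closed: "closed (E w)" and branch: "\<And>n. w \<in> cantor_scheme d M E (map \<sigma> [0..<n])"
  shows "inj_on (\<lambda>t. lim (\<lambda>n. d (center_index (\<sigma> n) (nat \<lfloor>t * 2 ^ n\<rfloor>)))) {0..<1::real}"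
proof (rule inj_onI, rule ccontr)
  fix t t' :: real
  assume t: "t \<in> {0..<1}" "t' \<in> {0..<1}" and ne: "t \<noteq> t'"
    and eq: "lim (\<lambda>n. d (center_index (\<sigma> n) (nat \<lfloor>t * 2 ^ n\<rfloor>)))
      = lim (\<lambda>n. d (center_index (\<sigma> n) (nat \<lfloor>t' * 2 ^ n\<rfloor>)))"
  obtain j where j: "nat \<lfloor>t * 2 ^ j\<rfloor> \<noteq> nat \<lfloor>t' * 2 ^ j\<rfloor>"
    using dyadic_floor_separates[OF ne] t by auto
  have lt: "nat \<lfloor>u * 2 ^ j\<rfloor> < 2 ^ j" if "u \<in> {0..<1}" for u :: real
  proof -
    have "u * 2 ^ j < 2 ^ j" using that by simp
    then have "\<lfloor>u * 2 ^ j\<rfloor> < 2 ^ j" by (simp add: floor_less_iff)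
    then show ?thesis using that by (simp add: nat_less_iff)
  qed
  have "separated_codes d (map \<sigma> [0..<Suc j])"
    using branch[of "Suc j"] by (simp add: cantor_scheme_def del: upt_Suc)
  then have sep: "2 / (real (scale (\<sigma> j)) + 1) <
      dist (d (center_index (\<sigma> j) (nat \<lfloor>t * 2 ^ j\<rfloor>))) (d (center_index (\<sigma> j) (nat \<lfloor>t' * 2 ^ j\<rfloor>)))"
    using lt t j unfolding separated_codes_def by (simp del: upt_Suc)
  define a where "a = lim (\<lambda>n. d (center_index (\<sigma> n) (nat \<lfloor>t * 2 ^ n\<rfloor>)))"
  have "dist a (d (center_index (\<sigma> j) (nat \<lfloor>t * 2 ^ j\<rfloor>))) \<le> 1 / (real (scale (\<sigma> j)) + 1)"
    unfolding a_def using cantor_branch_point(3)[where E=E and w=w, OF closed branch] t(1) by simp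
  moreover have "dist a (d (center_index (\<sigma> j) (nat \<lfloor>t' * 2 ^ j\<rfloor>))) \<le> 1 / (real (scale (\<sigma> j)) + 1)"
    unfolding a_def eq using cantor_branch_point(3)[where E=E and w=w, OF closed branch] t(2) by simp
  moreover have "dist (d (center_index (\<sigma> j) (nat \<lfloor>t * 2 ^ j\<rfloor>))) (d (center_index (\<sigma> j) (nat \<lfloor>t' * 2 ^ j\<rfloor>)))
      \<le> dist a (d (center_index (\<sigma> j) (nat \<lfloor>t * 2 ^ j\<rfloor>))) + dist a (d (center_index (\<sigma> j) (nat \<lfloor>t' * 2 ^ j\<rfloor>)))"
    by (rule dist_triangle3)
  ultimately show False using sep by (simp add: add_divide_distrib[symmetric])
qed

section \<open>Uniformization of uncountable sections\<close>

text \<open>The cells of the construction are open, so that a condensation point in a cell leaves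
  uncountably many points there.\<close>

definition open_cell :: "(nat \<Rightarrow> 'x::metric_space) \<Rightarrow> nat list \<Rightarrow> nat \<Rightarrow> 'x set" where
  "open_cell d p s = {y. \<forall>j<length p.
     dist y (d (center_index (p ! j) (s div 2 ^ (length p - j)))) < 1 / (real (scale (p ! j)) + 1)}"

text \<open>The invariant under which a finite code can be prolonged.\<close>

definition large_codes :: "(nat \<Rightarrow> 'x::metric_space) \<Rightarrow> 'x \<Rightarrow> 'x set \<Rightarrow> nat list \<Rightarrow> bool" where
  "large_codes d x \<Gamma> p \<longleftrightarrow> separated_codes d p \<and>
     (\<forall>j<length p. dist x (d (base_index (p ! j))) \<le> 1 / (real j + 1)) \<and>
     (\<forall>s<2 ^ length p. uncountable (\<Gamma> \<inter> open_cell d p s))"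

text \<open>Every cell of the present level contains infinitely many condensation points. Distinct ones are chosen,
  one for each index, and the new scale is taken so fine that balls around their approximations are disjoint. As
  the chosen points are condensation points, the smaller cells still meet \<open>\<Gamma>\<close> in uncountable sets.\<close>

lemma large_codes_extend:
  fixes d :: "nat \<Rightarrow> 'x::polish_space"
  assumes dense: "\<And>x e. e > 0 \<Longrightarrow> \<exists>i. dist x (d i) < e"
    and I: "large_codes d x \<Gamma> p"
  shows "\<exists>e. large_codes d x \<Gamma> (p @ [e])"
proof -
  define n where "n = length p"
  define Q where "Q = {y \<in> \<Gamma>. \<forall>U. open U \<longrightarrow> y \<in> U \<longrightarrow> uncountable (\<Gamma> \<inter> U)}"
  have ob: "open (open_cell d p s)" for s
  proof -
    have "open_cell d p s = (\<Inter>j\<in>{..<length p}. ball (d (center_index (p ! j) (s div 2 ^ (length p - j)))) (1 / (real (scale (p ! j)) + 1)))"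
      by (auto simp: open_cell_def dist_commute)
    also have "open \<dots>" by (intro open_INT) auto
    finally show ?thesis .
  qed
  have "infinite (Q \<inter> open_cell d p s)" if "s < 2 ^ n" for s
    unfolding Q_def using I that by (intro condensation_points) (simp add: large_codes_def n_def)
  then obtain y where inj: "inj_on y {..<2 ^ n}" and y: "\<And>s. s < 2 ^ n \<Longrightarrow> y s \<in> Q \<inter> open_cell d p s"
    using distinct_representatives_infinite[of "2 ^ n" "\<lambda>s. Q \<inter> open_cell d p s"] by blast
  obtain \<eta> where \<eta>: "\<eta> > 0" "\<And>s s'. s < 2 ^ n \<Longrightarrow> s' < 2 ^ n \<Longrightarrow> s \<noteq> s' \<Longrightarrow> \<eta> < dist (y s) (y s')"
    using finite_set_separated[OF inj] by blast
  obtain N where N: "\<And>l. l \<ge> N \<Longrightarrow> 1 / (real l + 1) < \<eta> / 4"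
    using order_tendstoD(2)[OF scale_tendsto_zero, of "\<eta> / 4"] \<eta>(1)
    by (auto simp: eventually_sequentially)
  \<comment> \<open>radius below \<open>\<eta> / 4\<close>: the centres are moved by less than one radius each and must stay two radii apart\<close>
  define l where "l = max n N"
  have l: "1 / (real l + 1) < \<eta> / 4" "n \<le> l" using N[of l] by (auto simp: l_def)
  have "\<exists>i. dist (y s) (d i) < 1 / (real l + 1)" for s by (rule dense) simp
  then obtain c where c: "\<And>s. dist (y s) (d (c s)) < 1 / (real l + 1)" by metis
  obtain a where a: "dist x (d a) < 1 / (real n + 1)" using dense[of "1 / (real n + 1)" x] by auto
  define e where "e = to_nat (a, l, map c [0..<2 ^ n])"
  have e: "base_index e = a" "scale e = l" "\<And>s. s < 2 ^ n \<Longrightarrow> center_index e s = c s"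
    by (simp_all add: e_def)
  have sep: "2 / (real l + 1) < dist (d (c s)) (d (c s'))" if "s < 2 ^ n" "s' < 2 ^ n" "s \<noteq> s'" for s s'
  proof -
    have "dist (y s) (y s') \<le> dist (y s) (d (c s)) + dist (d (c s)) (d (c s')) + dist (y s') (d (c s'))"
      using dist_triangle[of "y s" "y s'" "d (c s)"] dist_triangle2[of "d (c s)" "y s'" "d (c s')"] by linarith
    moreover have "2 / (real l + 1) = 1 / (real l + 1) + 1 / (real l + 1)" by simp
    ultimately show ?thesis using \<eta>(2)[OF that] c[of s] c[of s'] l(1) by linarith
  qed
  have "separated_codes d (p @ [e])"
    using I sep l(2) e unfolding large_codes_def separated_codes_def n_def[symmetric]
    by (auto simp: nth_append n_def less_Suc_eq)
  moreover have "\<forall>j<length (p @ [e]). dist x (d (base_index ((p @ [e]) ! j))) \<le> 1 / (real j + 1)"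
    using I a e(1) unfolding large_codes_def by (auto simp: nth_append n_def less_Suc_eq)
  moreover have "uncountable (\<Gamma> \<inter> open_cell d (p @ [e]) s)" if s: "s < 2 ^ Suc n" for s
  proof -
    have s2: "s div 2 < 2 ^ n" using s by simp
    have idx: "s div 2 ^ (Suc n - j) = (s div 2) div 2 ^ (n - j)" if "j \<le> n" for j
      using that by (simp add: Suc_diff_le div_mult2_eq)
    have "open_cell d p (s div 2) \<inter> ball (d (c (s div 2))) (1 / (real l + 1)) \<subseteq> open_cell d (p @ [e]) s"
    proof
      fix z assume z: "z \<in> open_cell d p (s div 2) \<inter> ball (d (c (s div 2))) (1 / (real l + 1))"
      show "z \<in> open_cell d (p @ [e]) s" unfolding open_cell_def mem_Collect_eq
      proof (intro allI impI)
        fix j assume j: "j < length (p @ [e])"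
        show "dist z (d (center_index ((p @ [e]) ! j) (s div 2 ^ (length (p @ [e]) - j))))
            < 1 / (real (scale ((p @ [e]) ! j)) + 1)"
        proof (cases "j = n")
          case True
          then show ?thesis using z e(2,3) s2 by (simp add: n_def nth_append dist_commute)
        next
          case False
          then have jn: "j < length p" using j by (simp add: n_def)
          then have "dist z (d (center_index (p ! j) ((s div 2) div 2 ^ (length p - j)))) < 1 / (real (scale (p ! j)) + 1)"
            using z by (simp add: open_cell_def)
          then show ?thesis using jn idx[of j] by (simp add: n_def nth_append)
        qed
      qed
    qed
    moreover have "uncountable (\<Gamma> \<inter> (open_cell d p (s div 2) \<inter> ball (d (c (s div 2))) (1 / (real l + 1))))"
    proof -
      have "y (s div 2) \<in> open_cell d p (s div 2) \<inter> ball (d (c (s div 2))) (1 / (real l + 1))"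
        using y[OF s2] c[of "s div 2"] by (simp add: dist_commute)
      moreover have "open (open_cell d p (s div 2) \<inter> ball (d (c (s div 2))) (1 / (real l + 1)))"
        using ob by auto
      ultimately show ?thesis using y[OF s2] unfolding Q_def by blast
    qed
    ultimately show ?thesis
      by (meson Int_mono countable_subset order_refl)
  qed
  ultimately show ?thesis unfolding large_codes_def by (intro exI[of _ e]) (simp add: n_def)
qed

lemma uncountable_section_imp_branch:
  fixes d :: "nat \<Rightarrow> 'x::polish_space"
  assumes dense: "\<And>x e. e > 0 \<Longrightarrow> \<exists>i. dist x (d i) < e"
    and w: "w \<in> space M" and unc: "uncountable {y. (x, y) \<in> E w}"
  shows "w \<in> suslin M (cantor_scheme d M E)"
proof -
  define \<Gamma> where "\<Gamma> = {y. (x, y) \<in> E w}"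
  have "large_codes d x \<Gamma> []" using unc by (simp add: large_codes_def separated_codes_def open_cell_def \<Gamma>_def)
  moreover have "\<exists>e. large_codes d x \<Gamma> (p @ [e])" if "large_codes d x \<Gamma> p" for p
    using dense that by (rule large_codes_extend)
  ultimately obtain \<sigma> where \<sigma>: "\<And>n. large_codes d x \<Gamma> (map \<sigma> [0..<n])"
    using dependent_list_choice[of "large_codes d x \<Gamma>"] by blast
  have "w \<in> cantor_scheme d M E (map \<sigma> [0..<n])" for n
  proof -
    define p where "p = map \<sigma> [0..<n]"
    have I: "large_codes d x \<Gamma> p" unfolding p_def by (rule \<sigma>)
    have "E w \<inter> code_box d p s \<noteq> {}" if "s < 2 ^ length p" for s
    proof -
      have "\<Gamma> \<inter> open_cell d p s \<noteq> {}" using I that by (auto simp: large_codes_def)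
      then obtain y where "y \<in> \<Gamma>" "y \<in> open_cell d p s" by blast
      then have "(x, y) \<in> E w \<inter> code_box d p s"
        using I by (auto simp: large_codes_def code_box_def open_cell_def \<Gamma>_def intro: less_imp_le)
      then show ?thesis by blast
    qed
    then show ?thesis using w I unfolding p_def[symmetric] by (simp add: cantor_scheme_def large_codes_def)
  qed
  then show ?thesis using w by (auto simp: suslin_def)
qed

text \<open>A measurable family of closed relations with uncountable sections: up to null sets the set of
  parameters is measurable, and injections of the unit interval into one section can be chosen measurably. Pushing Lebesgue
  measure forward along them produces non-atomic measures on these sections.\<close>

theorem uncountable_section_uniformization:
  fixes E :: "'w \<Rightarrow> ('x::polish_space \<times> 'x) set"
  assumes fin: "finite_measure M"
    and closed: "\<And>w. w \<in> space M \<Longrightarrow> closed (E w)"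
    and hit: "\<And>F. closed F \<Longrightarrow> {w \<in> space M. E w \<inter> F \<noteq> {}} \<in> sets M"
  obtains C H and \<phi> :: "'w \<Rightarrow> real \<Rightarrow> 'x" where
    "C \<in> sets M" "H \<in> sets M" "emeasure M (H - C) = 0"
    "{w \<in> space M. \<exists>x. uncountable {y. (x, y) \<in> E w}} \<subseteq> H"
    "(\<lambda>(w, t). \<phi> w t) \<in> M \<Otimes>\<^sub>M borel \<rightarrow>\<^sub>M borel"
    "\<And>w. w \<in> C \<Longrightarrow> inj_on (\<phi> w) {0..<1}"
    "\<And>w. w \<in> C \<Longrightarrow> \<exists>x. \<forall>t\<in>{0..<1}. (x, \<phi> w t) \<in> E w"
proof -
  obtain D :: "'x set" where D': "countable D \<and> (\<forall>U. open U \<longrightarrow> U \<noteq> {} \<longrightarrow> (\<exists>a\<in>D. a \<in> U))"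
    using countable_dense_exists[where 'a='x] by (elim exE)
  then have D: "countable D" "\<And>U. open U \<Longrightarrow> U \<noteq> {} \<Longrightarrow> \<exists>a\<in>D. a \<in> U"
    by simp_all
  define d where "d = from_nat_into D"
  have "D \<noteq> {}" using D(2)[of UNIV] by auto
  then have rD: "range d = D" unfolding d_def using D(1) by (rule range_from_nat_into)
  have dense: "\<exists>i. dist x (d i) < e" if "e > 0" for x e
  proof -
    obtain a where "a \<in> D" "a \<in> ball x e" using D(2)[of "ball x e"] \<open>e > 0\<close> by auto
    then show ?thesis using rD by (metis imageE mem_ball)
  qed
  have S: "cantor_scheme d M E p \<in> sets M" for p
    by (rule sets_cantor_scheme) (rule hit)
  obtain C H \<sigma> where C: "C \<in> sets M" "H \<in> sets M" "suslin M (cantor_scheme d M E) \<subseteq> H" "emeasure M (H - C) = 0"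
    and \<sigma>: "\<And>j. (\<lambda>w. \<sigma> w j) \<in> measurable M (count_space UNIV)"
    and br: "\<And>w n. w \<in> C \<Longrightarrow> w \<in> cantor_scheme d M E (map (\<sigma> w) [0..<n])"
  proof (rule suslin_uniformization[where S="cantor_scheme d M E", OF fin S], goal_cases)
    case (1 C H \<sigma>)
    show ?case by (rule 1(1)[OF 1(2-7)])
  qed
  define q where "q n w t = d (center_index (\<sigma> w n) (nat \<lfloor>t * 2 ^ n\<rfloor>))" for n w and t :: real
  \<comment> \<open>the default value \<open>d 0\<close> makes the approximating sequence converge everywhere\<close>
  define \<phi> where "\<phi> w t = (if w \<in> C \<and> t \<in> {0..<1} then lim (\<lambda>n. q n w t) else d 0)" for w and t :: real
  have cl: "closed (E w)" if "w \<in> C" for w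
    by (rule closed) (rule subsetD[OF sets.sets_into_space[OF C(1)] that])
  show thesis
  proof (rule that[OF C(1,2,4)])
    show "{w \<in> space M. \<exists>x. uncountable {y. (x, y) \<in> E w}} \<subseteq> H"
    proof
      fix w assume "w \<in> {w \<in> space M. \<exists>x. uncountable {y. (x, y) \<in> E w}}"
      then obtain x where "w \<in> space M" "uncountable {y. (x, y) \<in> E w}" by blast
      with dense have "w \<in> suslin M (cantor_scheme d M E)" by (rule uncountable_section_imp_branch)
      then show "w \<in> H" using C(3) by blast
    qed
    show "(\<lambda>(w, t). \<phi> w t) \<in> M \<Otimes>\<^sub>M borel \<rightarrow>\<^sub>M borel"
    proof (rule borel_measurable_LIMSEQ_metric)
      fix n
      have 1: "(\<lambda>p. \<sigma> (fst p) n) \<in> measurable (M \<Otimes>\<^sub>M (borel :: real measure)) (count_space UNIV)"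
        by (rule measurable_compose[OF measurable_fst \<sigma>])
      have 2: "(\<lambda>p. nat \<lfloor>snd p * 2 ^ n\<rfloor>) \<in> measurable (M \<Otimes>\<^sub>M (borel :: real measure)) (count_space UNIV)"
        by measurable
      have 3: "(\<lambda>p. d (center_index e (nat \<lfloor>snd p * 2 ^ n\<rfloor>))) \<in> borel_measurable (M \<Otimes>\<^sub>M (borel :: real measure))" for e
        by (rule measurable_compose_countable[where f="\<lambda>s p. d (center_index e s)", OF _ 2]) simp
      have [measurable]: "(\<lambda>p. q n (fst p) (snd p)) \<in> borel_measurable (M \<Otimes>\<^sub>M borel)"
        unfolding q_def
        by (rule measurable_compose_countable[where f="\<lambda>e p. d (center_index e (nat \<lfloor>snd p * 2 ^ n\<rfloor>))", OF 3 1])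
      have [measurable]: "C \<in> sets M" by (rule C(1))
      show "(\<lambda>p. if fst p \<in> C \<and> snd p \<in> {0..<1} then q n (fst p) (snd p) else d 0) \<in> borel_measurable (M \<Otimes>\<^sub>M borel)"
        by measurable
    next
      fix p :: "'w \<times> real"
      show "(\<lambda>n. if fst p \<in> C \<and> snd p \<in> {0..<1} then q n (fst p) (snd p) else d 0)
          \<longlonglongrightarrow> (case p of (w, t) \<Rightarrow> \<phi> w t)"
      proof (cases "fst p \<in> C \<and> snd p \<in> {0..<1}")
        case True
        then have "convergent (\<lambda>n. q n (fst p) (snd p))"
          unfolding q_def
          using cantor_branch_point(1)[where \<sigma>="\<sigma> (fst p)" and w="fst p" and t="snd p", OF cl br] by auto
        then show ?thesis using True by (simp add: \<phi>_def case_prod_beta convergent_LIMSEQ_iff)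
      next
        case False
        then have "(case p of (w, t) \<Rightarrow> \<phi> w t) = d 0" by (auto simp: \<phi>_def case_prod_beta)
        with False show ?thesis by (simp only: if_False tendsto_const)
      qed
    qed
    fix w assume w: "w \<in> C"
    have "inj_on (\<lambda>t. lim (\<lambda>n. q n w t)) {0..<1}"
      unfolding q_def by (rule cantor_branch_inj[where \<sigma>="\<sigma> w", OF cl[OF w] br[OF w]])
    then show "inj_on (\<phi> w) {0..<1}"
      using w by (simp add: \<phi>_def inj_on_def)
    have "(lim (\<lambda>n. d (base_index (\<sigma> w n))), \<phi> w t) \<in> E w" if "t \<in> {0..<1}" for t
      using cantor_branch_point(2)[where \<sigma>="\<sigma> w" and t=t, OF cl[OF w] br[OF w]] that w
      by (simp add: \<phi>_def q_def)
    then show "\<exists>x. \<forall>t\<in>{0..<1}. (x, \<phi> w t) \<in> E w" by blast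
  qed
qed

section \<open>Non-atomic measures\<close>

lemma nonatomic_imp_singleton_null:
  assumes "nonatomic M" "{x} \<in> sets M"
  shows "emeasure M {x} = 0"
proof (rule ccontr)
  assume "emeasure M {x} \<noteq> 0"
  then have "measure_atom M {x}"
    using assms(2) by (auto simp: measure_atom_def subset_singleton_iff zero_less_iff_neq_zero)
  then show False using assms(1) by (auto simp: nonatomic_def)
qed

text \<open>Each basic open set splits an atom into a null part and a full part. Discarding the countably many null
  parts leaves a set of full measure in the atom that has at most one point.\<close>

lemma nonatomic_if_singletons_null:
  fixes M :: "'x::{second_countable_topology, t1_space} measure"
  assumes "finite_measure M" and sM: "sets M = sets borel" and null: "\<And>x. emeasure M {x} = 0"
  shows "nonatomic M"
proof (unfold nonatomic_def, rule notI)
  interpret finite_measure M by fact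
  assume "\<exists>A. measure_atom M A"
  then obtain A where A [measurable]: "A \<in> sets M" and pos: "emeasure M A > 0"
    and atom: "\<And>B. B \<in> sets M \<Longrightarrow> B \<subseteq> A \<Longrightarrow> emeasure M B = 0 \<or> emeasure M B = emeasure M A"
    by (auto simp: measure_atom_def)
  obtain B :: "'x set set" where B: "countable B" "topological_basis B"
    using ex_countable_basis by blast
  have Bs: "b \<in> sets M" if "b \<in> B" for b
    using topological_basis_open[OF B(2) that] by (simp add: sM)
  define N where "N b = (if emeasure M (A \<inter> b) = 0 then A \<inter> b else A - b)" for b
  have N0: "N b \<in> null_sets M" if "b \<in> B" for b
  proof (cases "emeasure M (A \<inter> b) = 0")
    case True
    then show ?thesis using Bs[OF that] by (auto simp: N_def null_sets_def)
  next
    case False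
    then have "emeasure M (A \<inter> b) = emeasure M A" using atom[of "A \<inter> b"] Bs[OF that] by auto
    moreover have "emeasure M (A - A \<inter> b) = emeasure M A - emeasure M (A \<inter> b)"
      using Bs[OF that] by (intro emeasure_Diff) auto
    ultimately have "emeasure M (A - b) = 0" by (simp add: Diff_Int emeasure_eq_measure)
    then show ?thesis using Bs[OF that] False by (auto simp: N_def null_sets_def)
  qed
  have UN: "(\<Union>b\<in>B. N b) \<in> null_sets M"
    using B(1) N0 by (rule null_sets_UN')
  have sub: "\<exists>x. A - (\<Union>b\<in>B. N b) \<subseteq> {x}"
  proof (rule ccontr)
    assume no: "\<nexists>x. A - (\<Union>b\<in>B. N b) \<subseteq> {x}"
    then obtain x where x: "x \<in> A" "x \<notin> (\<Union>b\<in>B. N b)" by blast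
    from no obtain y where y: "y \<in> A" "y \<notin> (\<Union>b\<in>B. N b)" "y \<noteq> x" by blast
    obtain U where U: "open U" "x \<in> U" "y \<notin> U" using t1_space[of x y] y(3) by blast
    obtain b where b: "b \<in> B" "x \<in> b" "b \<subseteq> U"
      by (rule topological_basisE[OF B(2) U(1,2)])
    have "y \<notin> b" using b(3) U(3) by blast
    then show False using x y b by (auto simp: N_def split: if_splits)
  qed
  then obtain x where "A \<subseteq> {x} \<union> (\<Union>b\<in>B. N b)" by blast
  moreover have "{x} \<union> (\<Union>b\<in>B. N b) \<in> null_sets M"
    using UN null[of x] sM by (intro null_sets.Un) auto
  ultimately have "emeasure M A = 0"
    using null_sets_subset[OF _ A] by (simp add: null_sets_def)
  then show False using pos by simp
qed

section \<open>Orbits of the base map\<close>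

lemma base_pow_Suc:
  assumes "bij theta"
  shows "base_pow theta (k + 1) w = theta (base_pow theta k w)"
proof (cases "k \<ge> 0")
  case True
  then have "nat (k + 1) = Suc (nat k)" by simp
  then show ?thesis using True by (simp add: base_pow_def)
next
  case False
  define m where "m = nat (- k - 1)"
  have neg: "base_pow theta (- int n) = inv theta ^^ n" for n
    by (cases "n = 0") (simp_all add: base_pow_def)
  have k: "k = - int (Suc m)" "k + 1 = - int m" using False by (simp_all add: m_def)
  have "theta ((inv theta ^^ Suc m) w) = (inv theta ^^ m) w"
    using assms by (simp add: bij_is_surj surj_f_inv_f)
  then show ?thesis unfolding k(2) unfolding k(1) neg by simp
qed

lemma base_pow_add:
  assumes "bij theta"
  shows "base_pow theta (k + l) w = base_pow theta k (base_pow theta l w)"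
proof (induction k rule: int_induct[where k=0])
  case base then show ?case by (simp add: base_pow_def[of theta 0])
next
  case (step1 i)
  then show ?case using base_pow_Suc[OF assms, of "i + l" w] base_pow_Suc[OF assms, of i "base_pow theta l w"]
    by (simp add: algebra_simps)
next
  case (step2 i)
  have "theta (base_pow theta (i - 1 + l) w) = theta (base_pow theta (i - 1) (base_pow theta l w))"
    using step2 base_pow_Suc[OF assms, of "i - 1 + l" w] base_pow_Suc[OF assms, of "i - 1" "base_pow theta l w"]
    by (simp add: algebra_simps)
  then show ?case using assms by (simp add: bij_is_inj inj_eq)
qed

lemma base_pow_0 [simp]: "base_pow theta 0 w = w"
  by (simp add: base_pow_def)

definition periodic :: "('w \<Rightarrow> 'w) \<Rightarrow> 'w \<Rightarrow> bool" where
  "periodic theta w \<longleftrightarrow> (\<exists>p>0. base_pow theta p w = w)"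

lemma periodic_base_pow_iff:
  assumes "bij theta"
  shows "periodic theta (base_pow theta k w) \<longleftrightarrow> periodic theta w"
proof -
  have *: "periodic theta (base_pow theta k w)" if per: "periodic theta w" for k w
  proof -
    obtain p where "p > 0" "base_pow theta p w = w" using per by (auto simp: periodic_def)
    then have "base_pow theta p (base_pow theta k w) = base_pow theta k w"
      by (metis add.commute assms base_pow_add)
    then show ?thesis using \<open>p > 0\<close> by (auto simp: periodic_def)
  qed
  have "base_pow theta (- k) (base_pow theta k w) = w"
    by (simp flip: base_pow_add[OF assms])
  then show ?thesis using * by metis
qed

lemma aperiodic_base_pow_inj:
  assumes "bij theta" "\<not> periodic theta w" "base_pow theta k w = base_pow theta l w"
  shows "k = l"
proof (rule ccontr)
  have *: "periodic theta w" if "l < k" "base_pow theta k w = base_pow theta l w" for k l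
  proof -
    have "base_pow theta (k - l) w = base_pow theta (- l) (base_pow theta k w)"
      by (simp flip: base_pow_add[OF assms(1)])
    also have "\<dots> = w" by (simp add: that(2) flip: base_pow_add[OF assms(1)])
    finally show ?thesis using that(1) by (auto simp: periodic_def intro!: exI[of _ "k - l"])
  qed
  assume "k \<noteq> l"
  then show False using * assms(2,3) by (metis linorder_neqE)
qed

text \<open>Periodicity in positive time controls the negative times as well, because \<open>k\<close> may be reduced modulo the period.\<close>

lemma finite_orbit_if_periodic:
  assumes "bij theta" "periodic theta w"
  shows "finite (range (\<lambda>k. base_pow theta k w))"
proof -
  obtain p where p: "p > 0" "base_pow theta p w = w" using assms(2) by (auto simp: periodic_def)
  have pn: "base_pow theta (p * int n) w = w" for n
  proof (induction n)
    case (Suc n)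
    have "p * int (Suc n) = p + p * int n" by (simp add: algebra_simps)
    then show ?case using Suc p(2) by (simp add: base_pow_add[OF assms(1)])
  qed simp
  have pm: "base_pow theta (p * m) w = w" for m
  proof (cases "m \<ge> 0")
    case True then show ?thesis using pn[of "nat m"] by simp
  next
    case False
    have "base_pow theta (p * m) w = base_pow theta (p * m) (base_pow theta (p * int (nat (- m))) w)"
      by (simp only: pn)
    also have "\<dots> = base_pow theta (p * m + p * int (nat (- m))) w"
      by (simp only: base_pow_add[OF assms(1)])
    also have "p * m + p * int (nat (- m)) = 0" using False by simp
    finally show ?thesis by simp
  qed
  have "base_pow theta k w \<in> (\<lambda>k. base_pow theta k w) ` {0..<p}" for k
  proof -
    have "base_pow theta k w = base_pow theta (k mod p + p * (k div p)) w" by simp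
    also have "\<dots> = base_pow theta (k mod p) w" by (subst base_pow_add[OF assms(1)]) (simp only: pm)
    finally show ?thesis using p(1) by auto
  qed
  then have "range (\<lambda>k. base_pow theta k w) \<subseteq> (\<lambda>k. base_pow theta k w) ` {0..<p}" by blast
  then show ?thesis by (rule finite_subset) simp
qed

context continuous_homeo_rds begin

lemma space_P [simp]: "space P = UNIV"
  using sets_eq_imp_space_eq[OF sets_P] by simp

lemma measurable_base_pow [measurable]: "base_pow theta k \<in> P \<rightarrow>\<^sub>M P"
proof -
  have *: "(h ^^ n) \<in> P \<rightarrow>\<^sub>M P" if "h \<in> P \<rightarrow>\<^sub>M P" for h n
    by (induction n) (use that in \<open>auto simp: id_def intro: measurable_comp\<close>)
  show ?thesis unfolding base_pow_def
    using *[OF measurable_theta] *[OF measurable_inv_theta] by simp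
qed

lemma emeasure_vimage_theta:
  assumes "A \<in> sets P" shows "emeasure P (theta -` A) = emeasure P A"
  using emeasure_distr[OF measurable_theta assms] theta_preserving by simp

lemma sets_base_pow_vimage:
  assumes "A \<in> sets P" shows "base_pow theta k -` A \<in> sets P"
  using measurable_sets[OF measurable_base_pow assms] by simp

lemma emeasure_vimage_base_pow:
  assumes A: "A \<in> sets P" shows "emeasure P (base_pow theta k -` A) = emeasure P A"
proof -
  have step: "emeasure P (base_pow theta (i + 1) -` A) = emeasure P (base_pow theta i -` A)"
    if A: "A \<in> sets P" for A i
  proof -
    have "base_pow theta (i + 1) -` A = theta -` (base_pow theta i -` A)"
      using base_pow_add[OF bij_theta, of i 1] base_pow_Suc[OF bij_theta, of 0] by auto
    then show ?thesis using emeasure_vimage_theta[OF sets_base_pow_vimage[OF A]] by simp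
  qed
  show ?thesis
  proof (induction k rule: int_induct[where k=0])
    case base then show ?case by (simp add: vimage_def)
  next
    case (step1 i) then show ?case using step[OF A, of i] by simp
  next
    case (step2 i) then show ?case using step[OF A, of "i - 1"] by simp
  qed
qed

text \<open>Almost sure properties hold along whole orbits, since orbits have only countably many points and the
  base map preserves null sets.\<close>

lemma AE_orbit:
  assumes "AE w in P. Q w"
  shows "AE w in P. \<forall>k. Q (base_pow theta k w)"
proof -
  obtain N where N: "N \<in> null_sets P" "{w. \<not> Q w} \<subseteq> N"
    using assms by (auto simp: eventually_ae_filter)
  have "AE w in P. Q (base_pow theta k w)" for k
  proof (rule AE_I')
    show "base_pow theta k -` N \<in> null_sets P"
      using N(1) sets_base_pow_vimage emeasure_vimage_base_pow by (auto simp: null_sets_def)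
    show "{w \<in> space P. \<not> Q (base_pow theta k w)} \<subseteq> base_pow theta k -` N" using N(2) by auto
  qed
  then show ?thesis by (simp add: AE_all_countable)
qed

lemma sets_periodic [measurable]: "Measurable.pred P (periodic theta)"
proof -
  have [measurable]: "base_pow theta k \<in> borel_measurable P" for k
    using measurable_base_pow measurable_cong_sets[OF refl sets_P] by blast
  have [measurable]: "(\<lambda>w. w) \<in> borel_measurable P"
    by (rule measurable_ident_sets[OF sets_P])
  have "Measurable.pred P (\<lambda>w. dist (base_pow theta k w) w = 0)" for k
    by measurable
  then have "Measurable.pred P (\<lambda>w. base_pow theta k w = w)" for k
    by simp
  then show ?thesis unfolding periodic_def by measurable
qed

end

section \<open>Measurability of the fibre maps\<close>

context continuous_homeo_rds begin

lemma f_props: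
  "continuous_on UNIV (f w)" "continuous_on UNIV (inv (f w))" "inv (f w) (f w x) = x" "f w (inv (f w) x) = x"
  using homeo_f[of w] by (auto simp: homeomorphism_def)

text \<open>The preimage of a closed set \<open>F\<close> under the inverse of \<open>f w\<close> is the set of all \<open>(w, x)\<close> such that \<open>f w z = x\<close> for some
  \<open>z \<in> F\<close>, a projection along the compact set \<open>F\<close>.\<close>

lemma measurable_inv_f: "(\<lambda>(w, x). inv (f w) x) \<in> P \<Otimes>\<^sub>M borel \<rightarrow>\<^sub>M borel"
proof (rule borel_measurableI)
  fix U :: "'x set" assume U: "open U"
  have cpt: "compact (- U)"
    using compact_Int_closed[OF compact_X, of "- U"] U by (simp add: closed_def)
  have "{p \<in> space (P \<Otimes>\<^sub>M borel). \<exists>z\<in>- U. \<forall>i::unit. dist (f (fst p) z) (snd p) \<le> 0} \<in> sets (P \<Otimes>\<^sub>M borel)"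
  proof (rule sets_compact_projection[OF cpt])
    fix z :: 'x
    have "(\<lambda>p. (fst p, z)) \<in> (P \<Otimes>\<^sub>M (borel :: 'x measure)) \<rightarrow>\<^sub>M P \<Otimes>\<^sub>M borel" by measurable
    from measurable_compose[OF this measurable_f]
    have [measurable]: "(\<lambda>p. f (fst p) z) \<in> borel_measurable (P \<Otimes>\<^sub>M (borel :: 'x measure))" by simp
    show "(\<lambda>p. dist (f (fst p) z) (snd p)) \<in> borel_measurable (P \<Otimes>\<^sub>M borel)" by measurable
  next
    fix p :: "'w \<times> 'x"
    show "continuous_on (- U) (\<lambda>z. dist (f (fst p) z) (snd p))"
      by (intro continuous_intros continuous_on_subset[OF f_props(1)]) simp
  qed
  moreover have "{p \<in> space (P \<Otimes>\<^sub>M borel). \<exists>z\<in>- U. \<forall>i::unit. dist (f (fst p) z) (snd p) \<le> 0}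
     = space (P \<Otimes>\<^sub>M borel) - (\<lambda>(w, x). inv (f w) x) -` U \<inter> space (P \<Otimes>\<^sub>M borel)"
  proof -
    have "(\<exists>z\<in>- U. f w z = x) \<longleftrightarrow> inv (f w) x \<notin> U" for w x
      using f_props(3,4) by (metis ComplD ComplI)
    then show ?thesis by auto
  qed
  ultimately have "space (P \<Otimes>\<^sub>M borel) - (space (P \<Otimes>\<^sub>M borel)
      - (\<lambda>(w, x). inv (f w) x) -` U \<inter> space (P \<Otimes>\<^sub>M borel)) \<in> sets (P \<Otimes>\<^sub>M borel)"
    by (metis sets.compl_sets)
  then show "(\<lambda>(w, x). inv (f w) x) -` U \<inter> space (P \<Otimes>\<^sub>M borel) \<in> sets (P \<Otimes>\<^sub>M borel)"
    by (simp add: Diff_Diff_Int Int_absorb1)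
qed

lemma measurable_rds_iter: "(\<lambda>w. rds_iter theta f k w x) \<in> borel_measurable P"
proof -
  have "(\<lambda>w. forward_iter theta f n w x) \<in> borel_measurable P" for n
  proof (induction n)
    case (Suc n)
    have "(\<lambda>w. (base_pow theta (int n) w, forward_iter theta f n w x)) \<in> P \<rightarrow>\<^sub>M P \<Otimes>\<^sub>M borel"
      using Suc by measurable
    from measurable_compose[OF this measurable_f] show ?case by simp
  qed simp
  moreover have "(\<lambda>w. backward_iter theta f n w x) \<in> borel_measurable P" for n
  proof (induction n)
    case (Suc n)
    have "(\<lambda>w. (base_pow theta (- int (Suc n)) w, backward_iter theta f n w x)) \<in> P \<rightarrow>\<^sub>M P \<Otimes>\<^sub>M borel"
      using Suc by measurable
    from measurable_compose[OF this measurable_inv_f] show ?case by simp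
  qed simp
  ultimately show ?thesis by (cases "k \<ge> 0") (simp_all add: rds_iter_def)
qed

lemma continuous_rds_iter: "continuous_on A (rds_iter theta f k w)"
proof -
  have "continuous_on UNIV (forward_iter theta f n w)" for n
    by (induction n)
      (auto simp: id_def simp del: o_apply intro: continuous_on_compose continuous_on_subset[OF f_props(1)])
  moreover have "continuous_on UNIV (backward_iter theta f n w)" for n
    by (induction n)
      (auto simp: id_def simp del: o_apply intro: continuous_on_compose continuous_on_subset[OF f_props(2)])
  ultimately have "continuous_on UNIV (rds_iter theta f k w)" by (simp add: rds_iter_def)
  then show ?thesis by (rule continuous_on_subset) simp
qed

lemma inj_rds_iter: "inj (rds_iter theta f k w)"
proof -
  have "inj (f w)" "inj (inv (f w))" for w by (metis f_props(3) injI) (metis f_props(4) injI)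
  then have "inj (forward_iter theta f n w)" "inj (backward_iter theta f n w)" for n
    by (induction n; simp add: inj_compose)+
  then show ?thesis by (simp add: rds_iter_def)
qed

lemma continuous_dist_rds_iter:
  "continuous_on A (\<lambda>z. dist (rds_iter theta f k w (fst z)) (rds_iter theta f k w (snd z)))"
  by (intro continuous_on_dist continuous_on_compose2[OF continuous_rds_iter[of UNIV]] continuous_intros) auto

lemma measurable_dist_rds_iter [measurable]:
  "(\<lambda>w. dist (rds_iter theta f k w x) (rds_iter theta f k w y)) \<in> borel_measurable P"
  using measurable_rds_iter by measurable

lemma compact_closed_pairs: "closed F \<Longrightarrow> compact (F :: ('x \<times> 'x) set)"
  using compact_Int_closed[OF compact_Times[OF compact_X compact_X], of F] by simp

end

section \<open>Expansivity along aperiodic orbits\<close>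

text \<open>On each orbit, the \<open>n\<close>-th step keeps only the remaining points in \<open>U n\<close>, provided there are any; otherwise it
  keeps all remaining points. Thus no orbit is ever lost, while two points of the same orbit cannot
  both survive forever if the sets \<open>U n\<close> separate points.\<close>

primrec orbit_marker :: "('w \<Rightarrow> 'w) \<Rightarrow> (nat \<Rightarrow> 'w set) \<Rightarrow> nat \<Rightarrow> 'w set" where
  "orbit_marker theta U 0 = UNIV"
| "orbit_marker theta U (Suc n) = {w \<in> orbit_marker theta U n.
     w \<in> U n \<or> (\<forall>k. base_pow theta k w \<notin> orbit_marker theta U n \<inter> U n)}"

lemma orbit_marker_antimono: "m \<le> n \<Longrightarrow> orbit_marker theta U n \<subseteq> orbit_marker theta U m"
  by (induction rule: dec_induct) auto

lemma orbit_marker_meets_orbit: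
  assumes "bij theta"
  shows "\<exists>k. base_pow theta k w \<in> orbit_marker theta U n"
proof (induction n)
  case (Suc n)
  show ?case
  proof (cases "\<exists>k. base_pow theta k w \<in> orbit_marker theta U n \<inter> U n")
    case True then show ?thesis by auto
  next
    case False
    obtain k where "base_pow theta k w \<in> orbit_marker theta U n" using Suc by blast
    moreover have "base_pow theta l (base_pow theta k w) \<notin> orbit_marker theta U n \<inter> U n" for l
      using False by (simp flip: base_pow_add[OF assms])
    ultimately show ?thesis by auto
  qed
qed simp

lemma orbit_marker_Inter_unique:
  assumes sep: "\<And>v w. v \<noteq> w \<Longrightarrow> \<exists>n. v \<in> U n \<and> w \<notin> U n"
    and v: "\<And>n. v \<in> orbit_marker theta U n"
    and w: "\<And>n. w \<in> orbit_marker theta U n"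
    and k: "v = base_pow theta k w"
  shows "v = w"
proof (rule ccontr)
  assume "v \<noteq> w"
  then obtain n where "v \<in> U n" "w \<notin> U n" using sep by blast
  then show False using v[of n] w[of "Suc n"] k by auto
qed

context continuous_homeo_rds begin

lemma sets_orbit_marker:
  assumes "\<And>n. U n \<in> sets P"
  shows "orbit_marker theta U n \<in> sets P"
proof (induction n)
  case 0 then show ?case using sets.top[of P] by simp
next
  case (Suc n)
  note [measurable] = Suc assms
  have "{w \<in> space P. w \<in> orbit_marker theta U n \<and>
     (w \<in> U n \<or> (\<forall>k. base_pow theta k w \<notin> orbit_marker theta U n \<inter> U n))} \<in> sets P"
    by measurable
  then show ?case by simp
qed

text \<open>The translates of a set that meets each aperiodic orbit at most once are disjoint and have equal measure, so a
  finite measure leaves no room for them unless they are null.\<close>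

lemma aperiodic_transversal_null:
  assumes S: "S \<in> sets P"
    and uniq: "\<And>v w k. v \<in> S \<Longrightarrow> w \<in> S \<Longrightarrow> v = base_pow theta k w \<Longrightarrow> v = w"
  shows "emeasure P (S \<inter> {w. \<not> periodic theta w}) = 0"
proof (rule ccontr)
  interpret prob_space P by (rule prob_space_P)
  define T where "T = S \<inter> {w. \<not> periodic theta w}"
  define V where "V n = base_pow theta (int n) -` T" for n
  have "{w \<in> space P. w \<in> S \<and> \<not> periodic theta w} \<in> sets P" using S by measurable
  then have T: "T \<in> sets P" by (simp add: T_def Int_def)
  have V: "V n \<in> sets P" "emeasure P (V n) = emeasure P T" for n
    unfolding V_def using sets_base_pow_vimage[OF T] emeasure_vimage_base_pow[OF T] by auto
  have "disjoint_family V"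
    unfolding disjoint_family_on_def
  proof (intro ballI impI, rule ccontr)
    fix m n assume mn: "m \<noteq> n" and "V m \<inter> V n \<noteq> {}"
    then obtain w where w: "base_pow theta (int m) w \<in> T" "base_pow theta (int n) w \<in> T"
      by (auto simp: V_def)
    have "base_pow theta (int m) w = base_pow theta (int m - int n) (base_pow theta (int n) w)"
      by (simp flip: base_pow_add[OF bij_theta])
    then have "base_pow theta (int m) w = base_pow theta (int n) w"
      using uniq w by (auto simp: T_def)
    moreover have "\<not> periodic theta w"
      using w(1) periodic_base_pow_iff[OF bij_theta] by (auto simp: T_def)
    ultimately have "int m = int n" by (rule aperiodic_base_pow_inj[OF bij_theta, rotated])
    then show False using mn by simp
  qed
  then have "(\<lambda>n. prob (V n)) sums prob (\<Union>n. V n)"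
    using V(1) by (intro finite_measure_UNION) auto
  then have "summable (\<lambda>n::nat. prob T)"
    using V(2) by (auto simp: measure_def dest: sums_summable)
  then have "emeasure P T = 0" by (simp add: summable_const_iff emeasure_eq_measure)
  moreover assume "emeasure P (S \<inter> {w. \<not> periodic theta w}) \<noteq> 0"
  ultimately show False by (simp add: T_def)
qed

text \<open>The base points where distance at most \<open>1 / (l + 1)\<close> at time \<open>k\<close> does not guarantee distance less than
  \<open>1 / (n + 1)\<close> at time zero.\<close>

definition contracted_pair :: "int \<Rightarrow> nat \<Rightarrow> nat \<Rightarrow> 'w set" where
  "contracted_pair k n l = {w. \<exists>x y. 1 / (real n + 1) \<le> dist x y \<and>
     dist (rds_iter theta f k w x) (rds_iter theta f k w y) \<le> 1 / (real l + 1)}"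

lemma sets_contracted_pair: "contracted_pair k n l \<in> sets P"
proof -
  define F where "F = {z :: 'x \<times> 'x. 1 / (real n + 1) \<le> dist (fst z) (snd z)}"
  have F: "compact F"
    unfolding F_def by (intro compact_closed_pairs closed_Collect_le continuous_intros)
  have "{w \<in> space P. \<exists>z\<in>F. \<forall>i::unit. dist (rds_iter theta f k w (fst z)) (rds_iter theta f k w (snd z)) - 1 / (real l + 1) \<le> 0} \<in> sets P"
    by (rule sets_compact_projection[OF F])
      (auto intro!: continuous_on_diff continuous_dist_rds_iter continuous_on_const)
  then show ?thesis by (simp add: contracted_pair_def F_def)
qed

lemma contracted_pair_antimono:
  assumes "l \<le> l'" shows "contracted_pair k n l' \<subseteq> contracted_pair k n l"
proof -
  have "1 / (real l' + 1) \<le> 1 / (real l + 1)" using assms by (intro divide_left_mono) auto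
  then show ?thesis unfolding contracted_pair_def by (blast intro: order_trans)
qed

text \<open>Uniform continuity of the inverse of the \<open>k\<close>-th iterate, on a compact space.\<close>

lemma eventually_not_contracted_pair: "\<exists>l. w \<notin> contracted_pair k n l"
proof (rule ccontr)
  assume "\<not> ?thesis"
  then have "\<forall>l. \<exists>z :: 'x \<times> 'x. 1 / (real n + 1) \<le> dist (fst z) (snd z) \<and>
     dist (rds_iter theta f k w (fst z)) (rds_iter theta f k w (snd z)) \<le> 1 / (real l + 1)"
    by (auto simp: contracted_pair_def)
  from choice[OF this] obtain z :: "nat \<Rightarrow> 'x \<times> 'x" where z:
    "\<And>l. 1 / (real n + 1) \<le> dist (fst (z l)) (snd (z l))"
    "\<And>l. dist (rds_iter theta f k w (fst (z l))) (rds_iter theta f k w (snd (z l))) \<le> 1 / (real l + 1)"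
    by blast
  have "seq_compact (UNIV :: ('x \<times> 'x) set)"
    using compact_closed_pairs[OF closed_UNIV] by (simp add: compact_eq_seq_compact_metric)
  then obtain a r where r: "strict_mono r" "(z \<circ> r) \<longlonglongrightarrow> a"
    by (rule seq_compactE[where f=z]) auto
  have lz: "(\<lambda>l. g (z (r l))) \<longlonglongrightarrow> g a" if "continuous_on UNIV g" for g :: "'x \<times> 'x \<Rightarrow> real"
    using continuous_on_tendsto_compose[OF that r(2)] by simp
  have "dist (rds_iter theta f k w (fst a)) (rds_iter theta f k w (snd a)) \<le> 0"
  proof (rule LIMSEQ_le[OF lz[OF continuous_dist_rds_iter] scale_tendsto_zero])
    show "\<exists>N. \<forall>m\<ge>N. dist (rds_iter theta f k w (fst (z (r m)))) (rds_iter theta f k w (snd (z (r m)))) \<le> 1 / (real m + 1)"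
    proof (intro exI allI impI)
      fix m :: nat
      have "1 / (real (r m) + 1) \<le> 1 / (real m + 1)"
        using seq_suble[OF r(1), of m] by (intro divide_left_mono) auto
      then show "dist (rds_iter theta f k w (fst (z (r m)))) (rds_iter theta f k w (snd (z (r m)))) \<le> 1 / (real m + 1)"
        using z(2)[of "r m"] by linarith
    qed
  qed
  then have "fst a = snd a" using inj_rds_iter by (simp add: inj_eq)
  moreover have "1 / (real n + 1) \<le> dist (fst a) (snd a)"
  proof (rule LIMSEQ_le_const)
    show "(\<lambda>l. dist (fst (z (r l))) (snd (z (r l)))) \<longlonglongrightarrow> dist (fst a) (snd a)"
      by (rule lz) (intro continuous_intros)
  qed (use z(1) in auto)
  ultimately show False by (simp add: divide_le_0_iff)
qed

text \<open>No expansivity of the fibre maps enters. An aperiodic point outside \<open>bad n l\<close> visits the marker \<open>A n\<close> at a time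
  within \<open>l\<close> at which distances up to \<open>1 / (l + 1)\<close> force distance less than \<open>1 / (n + 1)\<close> at time zero. For fixed \<open>n\<close>
  the bad sets shrink to the empty set as \<open>l\<close> grows, so sizes \<open>L n\<close> with summable bad sets exist. With the radius
  \<open>\<delta> w = 1 / (L (N w) + 1)\<close>, where \<open>N w\<close> is the first index of a marker without \<open>w\<close>, almost every aperiodic point benefits from all
  large \<open>n\<close>.\<close>

theorem aperiodic_expansive:
  obtains \<delta> where "positive_rv P \<delta>"
    "AE w in P. \<not> periodic theta w \<longrightarrow> (\<forall>x. dyn_ball theta f \<delta> x w \<subseteq> {x})"
proof -
  interpret prob_space P by (rule prob_space_P)
  obtain B :: "'w set set" where B: "countable B" "topological_basis B"
    using ex_countable_basis by blast
  define U where "U = from_nat_into (insert UNIV B)"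
  have rU: "range U = insert UNIV B"
    unfolding U_def using B(1) by (intro range_from_nat_into) auto
  have "open (U n)" for n
  proof -
    have "U n \<in> insert UNIV B" using rU by blast
    then show ?thesis using topological_basis_open[OF B(2)] by auto
  qed
  then have U: "U n \<in> sets P" for n by (simp add: sets_P)
  have sep: "\<exists>n. v \<in> U n \<and> w \<notin> U n" if vw: "v \<noteq> w" for v w
  proof -
    obtain V where V: "open V" "v \<in> V" "w \<notin> V" using t1_space[OF vw] by blast
    obtain b where b: "b \<in> B" "v \<in> b" "b \<subseteq> V" by (rule topological_basisE[OF B(2) V(1,2)])
    have "b \<in> range U" using rU b(1) by simp
    then show ?thesis using b V(3) by auto
  qed
  define A where "A = orbit_marker theta U"
  have A [measurable]: "A n \<in> sets P" for n
    unfolding A_def by (rule sets_orbit_marker[OF U])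
  have Anull: "emeasure P ((\<Inter>n. A n) \<inter> {w. \<not> periodic theta w}) = 0"
  proof (rule aperiodic_transversal_null)
    show "(\<Inter>n. A n) \<in> sets P" using A by (intro sets.countable_INT) auto
    fix v w k assume "v \<in> (\<Inter>n. A n)" "w \<in> (\<Inter>n. A n)" "v = base_pow theta k w"
    then show "v = w" by (intro orbit_marker_Inter_unique[OF sep, of v theta w k]) (auto simp: A_def)
  qed
  define G where "G = contracted_pair"
  have [measurable]: "G k n l \<in> sets P" for k n l unfolding G_def by (rule sets_contracted_pair)
  define bad where "bad n l = {w \<in> space P. \<not> periodic theta w \<and>
      (\<forall>k. \<bar>k\<bar> \<le> int l \<and> base_pow theta k w \<in> A n \<longrightarrow> w \<in> G k n l)}" for n l
  have bad [measurable]: "bad n l \<in> sets P" for n l unfolding bad_def by measurable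
  have bad_anti: "bad n l' \<subseteq> bad n l" if "l \<le> l'" for n l l'
    unfolding bad_def G_def using contracted_pair_antimono[OF that] that by fastforce
  have bad_empty: "(\<Inter>l. bad n l) = {}" for n
  proof (rule ccontr)
    assume "(\<Inter>l. bad n l) \<noteq> {}"
    then obtain w where w: "\<And>l. w \<in> bad n l" by blast
    obtain k where k: "base_pow theta k w \<in> A n"
      unfolding A_def using orbit_marker_meets_orbit[OF bij_theta] by blast
    obtain l where l: "w \<notin> G k n l" unfolding G_def using eventually_not_contracted_pair by blast
    have "w \<notin> G k n (max l (nat \<bar>k\<bar>))"
      using l contracted_pair_antimono[of l "max l (nat \<bar>k\<bar>)"] unfolding G_def by fastforce
    moreover have "\<bar>k\<bar> \<le> int (max l (nat \<bar>k\<bar>))" by simp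
    ultimately show False using w[of "max l (nat \<bar>k\<bar>)"] k unfolding bad_def by blast
  qed
  have "\<exists>l. prob (bad n l) < (1 / 2) ^ n" for n
  proof -
    have "(\<lambda>l. prob (bad n l)) \<longlonglongrightarrow> prob (\<Inter>l. bad n l)"
      using bad_anti by (intro finite_Lim_measure_decseq) (auto simp: decseq_def)
    then have "(\<lambda>l. prob (bad n l)) \<longlonglongrightarrow> 0" by (simp add: bad_empty)
    then have "\<forall>\<^sub>F l in sequentially. prob (bad n l) < (1 / 2) ^ n"
      by (rule order_tendstoD(2)) simp
    then show ?thesis by (auto simp: eventually_sequentially)
  qed
  then obtain L0 where L0: "\<And>n. prob (bad n (L0 n)) < (1 / 2) ^ n" by metis
  \<comment> \<open>monotone, so that a point in a deeper marker has a smaller radius\<close>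
  define L where "L n = (\<Sum>i\<le>n. L0 i)" for n
  have L0L: "L0 n \<le> L n" for n unfolding L_def by (intro member_le_sum) auto
  have Lmono: "L m \<le> L n" if "m \<le> n" for m n
    unfolding L_def using that by (intro sum_mono2) auto
  have L: "prob (bad n (L n)) \<le> (1 / 2) ^ n" for n
    using finite_measure_mono[OF bad_anti[OF L0L[of n], of n] bad] L0[of n] by linarith
  have BC: "AE w in P. \<forall>\<^sub>F n in sequentially. w \<in> space P - bad n (L n)"
  proof (rule borel_cantelli_AE1)
    show "summable (\<lambda>n. prob (bad n (L n)))"
      by (rule summable_comparison_test[OF _ summable_geometric[of "1/2 :: real"]]) (use L in auto)
  qed (auto simp: emeasure_eq_measure)
  \<comment> \<open>the markers decrease, so a point of \<open>A n\<close> outside their intersection has \<open>n < N w\<close>\<close>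
  define N where "N w = (LEAST n. w \<notin> A n)" for w
  have [measurable]: "N \<in> measurable P (count_space UNIV)" unfolding N_def by measurable
  define \<delta> where "\<delta> w = 1 / (real (L (N w)) + 1)" for w
  have "positive_rv P \<delta>" unfolding positive_rv_def \<delta>_def by (auto intro: add_nonneg_pos)
  moreover have "AE w in P. \<not> periodic theta w \<longrightarrow> w \<notin> (\<Inter>n. A n)"
  proof (rule AE_I')
    have "(\<Inter>n. A n) \<inter> {w. \<not> periodic theta w} = {w \<in> space P. (\<forall>n. w \<in> A n) \<and> \<not> periodic theta w}" by auto
    also have "\<dots> \<in> sets P" by measurable
    finally show "(\<Inter>n. A n) \<inter> {w. \<not> periodic theta w} \<in> null_sets P"
      using Anull by (simp add: null_sets_def)
  qed auto
  then have "AE w in P. \<forall>k. \<not> periodic theta (base_pow theta k w) \<longrightarrow> base_pow theta k w \<notin> (\<Inter>n. A n)"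
    by (rule AE_orbit)
  with BC have "AE w in P. \<not> periodic theta w \<longrightarrow> (\<forall>x. dyn_ball theta f \<delta> x w \<subseteq> {x})"
  proof (rule AE_mp[OF AE_conjI], intro AE_I2 impI allI subsetI)
    fix w x y
    assume H: "(\<forall>\<^sub>F n in sequentially. w \<in> space P - bad n (L n)) \<and>
        (\<forall>k. \<not> periodic theta (base_pow theta k w) \<longrightarrow> base_pow theta k w \<notin> (\<Inter>n. A n))"
      and ap: "\<not> periodic theta w" and y: "y \<in> dyn_ball theta f \<delta> x w"
    have close: "dist x y < 1 / (real n + 1)" if n: "w \<in> space P - bad n (L n)" for n
    proof -
      obtain k where k: "base_pow theta k w \<in> A n" "w \<notin> G k n (L n)"
        using n ap unfolding bad_def by auto
      have "base_pow theta k w \<notin> (\<Inter>n. A n)" using H ap periodic_base_pow_iff[OF bij_theta] by blast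
      then have "\<exists>m. base_pow theta k w \<notin> A m" by blast
      then have "base_pow theta k w \<notin> A (N (base_pow theta k w))" unfolding N_def by (rule LeastI_ex)
      then have "n \<le> N (base_pow theta k w)"
        using k(1) orbit_marker_antimono[of "N (base_pow theta k w)" n theta U] unfolding A_def
        by (meson nat_le_linear subsetD)
      then have "\<delta> (base_pow theta k w) \<le> 1 / (real (L n) + 1)"
        unfolding \<delta>_def using Lmono by (intro divide_left_mono) auto
      moreover have "dist (rds_iter theta f k w x) (rds_iter theta f k w y) \<le> \<delta> (base_pow theta k w)"
        using y by (simp add: dyn_ball_def)
      ultimately show ?thesis using k(2)
        unfolding G_def contracted_pair_def mem_Collect_eq by (meson not_le order_trans)
    qed
    have "\<forall>\<^sub>F n in sequentially. dist x y \<le> 1 / (real n + 1)"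
      by (rule eventually_mono[OF H[THEN conjunct1]]) (rule less_imp_le[OF close])
    then have "dist x y \<le> 0"
      by (intro tendsto_lowerbound[OF scale_tendsto_zero]) auto
    then show "y \<in> {x}" by simp
  qed
  ultimately show thesis by (rule that)
qed

end

section \<open>Countable balls are null for non-atomic measures\<close>

lemma (in continuous_homeo_rds) countably_imp_measure_expansive:
  assumes "random_countably_expansive P theta f"
  shows "random_measure_expansive P theta f"
proof -
  obtain \<delta> where d: "positive_rv P \<delta>" "AE w in P. \<forall>x. countable (dyn_ball theta f \<delta> x w)"
    using assms by (auto simp: random_countably_expansive_def)
  show ?thesis unfolding random_measure_expansive_def
  proof (intro ballI impI)
    fix \<mu> :: "('w \<times> 'x) measure"
    assume "nonatomic_factorization P \<mu>"
    then obtain \<kappa> where k: "disintegration P \<mu> \<kappa>" "AE w in P. nonatomic (\<kappa> w)"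
      by (auto simp: nonatomic_factorization_def)
    have km: "\<kappa> \<in> P \<rightarrow>\<^sub>M prob_algebra borel" using k(1) by (simp add: disintegration_def)
    have "AE w in P. \<forall>x. emeasure (\<kappa> w) (dyn_ball theta f \<delta> x w) = 0"
      using d(2) k(2)
    proof (rule AE_mp[OF AE_conjI], intro AE_I2 impI allI)
      fix w x assume w: "w \<in> space P"
        and H: "(\<forall>x. countable (dyn_ball theta f \<delta> x w)) \<and> nonatomic (\<kappa> w)"
      have s: "sets (\<kappa> w) = sets borel"
        using measurable_space[OF km w] by (simp add: space_prob_algebra)
      have "(\<Union>y\<in>dyn_ball theta f \<delta> x w. {y}) \<in> null_sets (\<kappa> w)"
        using H by (intro null_sets_UN') (auto simp: null_sets_def s intro!: nonatomic_imp_singleton_null)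
      then show "emeasure (\<kappa> w) (dyn_ball theta f \<delta> x w) = 0" by (simp add: null_sets_def)
    qed
    then show "random_expansive_measure P theta f \<mu>"
      using d(1) k(1) by (auto simp: random_expansive_measure_def)
  qed
qed

section \<open>The parameter space of the averaged kernel\<close>

text \<open>The probability space that drives the averaged kernel: the natural number selects the radius, the
  real number is the argument of the injection. The geometric distribution gives positive mass to every number, so no radius is
  lost in the average.\<close>

definition index_parameter :: "(nat \<times> real) measure" where
  "index_parameter = measure_pmf (geometric_pmf (1/2)) \<Otimes>\<^sub>M uniform_measure lborel {0..<1}"

lemma sets_index_parameter [measurable_cong]: "sets index_parameter = sets (count_space UNIV \<Otimes>\<^sub>M borel)"
  unfolding index_parameter_def by (rule sets_pair_measure_cong) simp_all

lemma space_index_parameter [simp]: "space index_parameter = UNIV"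
  by (simp add: index_parameter_def space_pair_measure)

lemma prob_space_unit_interval: "prob_space (uniform_measure lborel {0..<1::real})"
  by (rule prob_space_uniform_measure) auto

lemma prob_space_index_parameter: "prob_space index_parameter"
  unfolding index_parameter_def
  by (intro prob_space_pair prob_space_unit_interval prob_space_measure_pmf)

lemma emeasure_index_parameter:
  assumes "X \<in> sets index_parameter"
  shows "emeasure index_parameter X
    = (\<integral>\<^sup>+ n. emeasure (uniform_measure lborel {0..<1}) (Pair n -` X) \<partial>measure_pmf (geometric_pmf (1/2)))"
proof -
  interpret prob_space "uniform_measure lborel {0..<1::real}" by (rule prob_space_unit_interval)
  show ?thesis using assms unfolding index_parameter_def by (rule emeasure_pair_measure_alt)
qed

lemma index_parameter_null:
  assumes X: "X \<in> sets index_parameter" and "\<And>n. countable (Pair n -` X \<inter> {0..<1})"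
  shows "emeasure index_parameter X = 0"
proof -
  have "emeasure (uniform_measure lborel {0..<1}) (Pair n -` X) = 0" for n
  proof -
    have "Pair n -` X \<in> sets (borel :: real measure)"
      using sets_Pair1[of X "count_space UNIV" borel n] X sets_index_parameter by blast
    then have "emeasure (uniform_measure lborel {0..<1}) (Pair n -` X) =
        emeasure lborel ({0..<1} \<inter> Pair n -` X) / emeasure lborel {0..<1::real}"
      by (intro emeasure_uniform_measure) simp_all
    also have "emeasure lborel ({0..<1} \<inter> Pair n -` X) = 0"
      using assms(2)[of n] by (intro emeasure_lborel_countable) (simp add: Int_commute)
    finally show ?thesis by simp
  qed
  then show ?thesis by (simp add: emeasure_index_parameter[OF X])
qed

lemma index_parameter_pos:
  assumes X: "X \<in> sets index_parameter" and sub: "{n} \<times> {0..<1} \<subseteq> X"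
  shows "emeasure index_parameter X \<noteq> 0"
proof
  assume "emeasure index_parameter X = 0"
  then have "(\<integral>\<^sup>+ n. emeasure (uniform_measure lborel {0..<1}) (Pair n -` X) \<partial>measure_pmf (geometric_pmf (1/2))) = 0"
    by (simp add: emeasure_index_parameter[OF X])
  then have "AE n in measure_pmf (geometric_pmf (1/2)). emeasure (uniform_measure lborel {0..<1}) (Pair n -` X) = 0"
    by (subst (asm) nn_integral_0_iff_AE) simp_all
  then have z: "emeasure (uniform_measure lborel {0..<1}) (Pair n -` X) = 0"
    by (simp add: AE_measure_pmf_iff set_pmf_geometric)
  have m: "Pair n -` X \<in> sets (borel :: real measure)"
    using sets_Pair1[of X "count_space UNIV" borel n] X sets_index_parameter by blast
  have "emeasure (uniform_measure lborel {0..<1}) (Pair n -` X) =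
      emeasure lborel ({0..<1} \<inter> Pair n -` X) / emeasure lborel {0..<1::real}"
    using m by (intro emeasure_uniform_measure) simp_all
  also have "{0..<1} \<inter> Pair n -` X = {0..<1}" using sub by auto
  finally show False using z by simp
qed

section \<open>Dynamical balls over periodic points\<close>

context continuous_homeo_rds begin

text \<open>Over a periodic point, the pairs \<open>(x, y)\<close> such that \<open>y\<close> lies in the dynamical ball of constant radius
  \<open>1 / (n + 1)\<close> at \<open>x\<close>. The relation is empty over aperiodic points.\<close>

definition shadow_pairs :: "nat \<Rightarrow> 'w \<Rightarrow> ('x \<times> 'x) set" where
  "shadow_pairs n w = {z. periodic theta w \<and>
     (\<forall>k. dist (rds_iter theta f k w (fst z)) (rds_iter theta f k w (snd z)) \<le> 1 / (real n + 1))}"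

lemma closed_shadow_pairs: "closed (shadow_pairs n w)"
proof (cases "periodic theta w")
  case True
  have "closed {z. \<forall>k. dist (rds_iter theta f k w (fst z)) (rds_iter theta f k w (snd z)) \<le> 1 / (real n + 1)}"
    by (intro closed_Collect_all closed_Collect_le continuous_dist_rds_iter continuous_on_const)
  then show ?thesis using True by (simp add: shadow_pairs_def)
qed (simp add: shadow_pairs_def)

lemma sets_shadow_pairs_hit:
  assumes "closed F"
  shows "{w \<in> space P. shadow_pairs n w \<inter> F \<noteq> {}} \<in> sets P"
proof -
  have [measurable]: "{w \<in> space P. \<exists>z\<in>F. \<forall>k::int.
      dist (rds_iter theta f k w (fst z)) (rds_iter theta f k w (snd z)) - 1 / (real n + 1) \<le> 0} \<in> sets P"
    by (rule sets_compact_projection[OF compact_closed_pairs[OF assms]])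
      (auto intro!: continuous_on_diff continuous_dist_rds_iter continuous_on_const)
  have "{w \<in> space P. shadow_pairs n w \<inter> F \<noteq> {}} = {w \<in> space P. periodic theta w} \<inter>
     {w \<in> space P. \<exists>z\<in>F. \<forall>k::int.
      dist (rds_iter theta f k w (fst z)) (rds_iter theta f k w (snd z)) - 1 / (real n + 1) \<le> 0}"
    by (auto simp: shadow_pairs_def disjoint_iff simp del: split_paired_All split_paired_Ex)
  also have "\<dots> \<in> sets P" by measurable
  finally show ?thesis .
qed

lemma periodic_orbit_lower_bound:
  assumes "positive_rv P \<delta>" "periodic theta w"
  shows "\<exists>n. \<forall>k. 1 / (real n + 1) \<le> \<delta> (base_pow theta k w)"
proof -
  define D where "D = \<delta> ` range (\<lambda>k. base_pow theta k w)"
  have D: "finite D" "D \<noteq> {}" unfolding D_def using finite_orbit_if_periodic[OF bij_theta assms(2)] by auto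
  have "Min D \<in> D" using D by (rule Min_in)
  then have "Min D > 0" using assms(1) by (auto simp: D_def positive_rv_def)
  then obtain n where n: "1 / (real n + 1) < Min D"
    using order_tendstoD(2)[OF scale_tendsto_zero, of "Min D"] by (auto simp: eventually_sequentially)
  have "1 / (real n + 1) \<le> \<delta> (base_pow theta k w)" for k
  proof -
    have "Min D \<le> \<delta> (base_pow theta k w)" using D(1) by (rule Min_le) (simp add: D_def)
    then show ?thesis using n by linarith
  qed
  then show ?thesis by blast
qed

text \<open>Off the null set, a periodic \<open>w\<close> has a least \<open>n\<close> with \<open>w\<close> outside \<open>H n\<close>, hence countable balls of constant radius
  \<open>1 / (n + 1)\<close>. The radius \<open>\<delta>\<close> must be small along the whole orbit of \<open>w\<close>, so this \<open>n\<close> is replaced by its maximum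
  over the orbit, which is constant along the orbit.\<close>

lemma countably_expansive_if_hulls_null:
  assumes H: "\<And>n. H n \<in> sets P"
    and unc: "\<And>n. {w \<in> space P. \<exists>x. uncountable {y. (x, y) \<in> shadow_pairs n w}} \<subseteq> H n"
    and null: "emeasure P {w \<in> space P. periodic theta w \<and> (\<forall>n. w \<in> H n)} = 0"
  shows "random_countably_expansive P theta f"
proof -
  note [measurable] = H
  obtain \<delta>' where d': "positive_rv P \<delta>'"
    "AE w in P. \<not> periodic theta w \<longrightarrow> (\<forall>x. dyn_ball theta f \<delta>' x w \<subseteq> {x})"
    by (rule aperiodic_expansive)
  define a where "a w = (LEAST n. w \<notin> H n)" for w
  define b where "b w = (LEAST m. \<forall>k. a (base_pow theta k w) \<le> m)" for w
  have [measurable]: "a \<in> measurable P (count_space UNIV)" unfolding a_def by measurable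
  have [measurable]: "b \<in> measurable P (count_space UNIV)" unfolding b_def by measurable
  have ab: "a w \<le> b (base_pow theta k w)" if per: "periodic theta w" for w k
  proof -
    define v where "v = base_pow theta k w"
    have "finite (range (\<lambda>j. base_pow theta j v))"
      unfolding v_def using per periodic_base_pow_iff[OF bij_theta] by (intro finite_orbit_if_periodic[OF bij_theta]) blast
    then have fin: "finite (a ` range (\<lambda>j. base_pow theta j v))" by simp
    have "\<forall>j. a (base_pow theta j v) \<le> Max (a ` range (\<lambda>j. base_pow theta j v))"
      using fin by (auto intro: Max_ge)
    then have "\<exists>m. \<forall>j. a (base_pow theta j v) \<le> m" by blast
    then have "\<forall>j. a (base_pow theta j v) \<le> b v" unfolding b_def by (rule LeastI_ex)
    then have "a (base_pow theta (- k) v) \<le> b v" by blast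
    then show ?thesis unfolding v_def by (simp flip: base_pow_add[OF bij_theta])
  qed
  define \<delta> where "\<delta> w = (if periodic theta w then 1 / (real (b w) + 1) else \<delta>' w)" for w
  have [measurable]: "\<delta>' \<in> borel_measurable P" using d'(1) by (simp add: positive_rv_def)
  have pos: "positive_rv P \<delta>"
    using d'(1) unfolding positive_rv_def \<delta>_def by (auto intro: add_nonneg_pos)
  have hulls: "{w \<in> space P. periodic theta w \<and> (\<forall>n. w \<in> H n)} \<in> sets P" by measurable
  have "AE w in P. \<not> (periodic theta w \<and> (\<forall>n. w \<in> H n))"
  proof (rule AE_I')
    show "{w \<in> space P. periodic theta w \<and> (\<forall>n. w \<in> H n)} \<in> null_sets P"
      using null hulls by (simp add: null_sets_def)
  qed auto
  with d'(2) have "AE w in P. \<forall>x. countable (dyn_ball theta f \<delta> x w)"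
  proof (rule AE_mp[OF AE_conjI], intro AE_I2 impI allI)
    fix w x
    assume D: "(\<not> periodic theta w \<longrightarrow> (\<forall>x. dyn_ball theta f \<delta>' x w \<subseteq> {x})) \<and>
      \<not> (periodic theta w \<and> (\<forall>n. w \<in> H n))"
    show "countable (dyn_ball theta f \<delta> x w)"
    proof (cases "periodic theta w")
      case True
      then have "\<exists>n. w \<notin> H n" using D by blast
      then have "w \<notin> H (a w)" unfolding a_def by (rule LeastI_ex)
      then have c: "countable {y. (x, y) \<in> shadow_pairs (a w) w}" using unc by auto
      have "\<delta> (base_pow theta k w) \<le> 1 / (real (a w) + 1)" for k
        using ab[OF True, of k] True periodic_base_pow_iff[OF bij_theta]
        by (auto simp: \<delta>_def intro!: divide_left_mono)
      then have "dyn_ball theta f \<delta> x w \<subseteq> {y. (x, y) \<in> shadow_pairs (a w) w}"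
        using True by (auto simp: dyn_ball_def shadow_pairs_def intro: order_trans)
      then show ?thesis using c by (rule countable_subset)
    next
      case False
      then have "dyn_ball theta f \<delta> x w = dyn_ball theta f \<delta>' x w"
        using periodic_base_pow_iff[OF bij_theta] by (simp add: dyn_ball_def \<delta>_def)
      then have "dyn_ball theta f \<delta> x w \<subseteq> {x}" using D False by simp
      then show ?thesis by (rule countable_subset) simp
    qed
  qed
  then show ?thesis using pos by (auto simp: random_countably_expansive_def)
qed

text \<open>The kernel sends \<open>w\<close> to the average over \<open>n\<close> of the images of Lebesgue measure under \<open>\<phi> n w\<close>; it is non-atomic
  because the maps are injective. Given any \<open>\<delta>\<close>, over each \<open>w \<in> K\<close> some constant \<open>1 / (n + 1)\<close> is below \<open>\<delta>\<close> along the finite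
  orbit, and the \<open>n\<close>-th component of the kernel is concentrated on a ball of that radius.\<close>

lemma not_measure_expansive_if_scrambled:
  fixes \<phi> :: "nat \<Rightarrow> 'w \<Rightarrow> real \<Rightarrow> 'x"
  assumes K: "K \<in> sets P" "emeasure P K \<noteq> 0"
    and meas: "\<And>n. (\<lambda>(w, t). \<phi> n w t) \<in> P \<Otimes>\<^sub>M borel \<rightarrow>\<^sub>M borel"
    and inj: "\<And>n w. w \<in> K \<Longrightarrow> inj_on (\<phi> n w) {0..<1}"
    and shadow: "\<And>n w. w \<in> K \<Longrightarrow> \<exists>x. \<forall>t\<in>{0..<1}. (x, \<phi> n w t) \<in> shadow_pairs n w"
  shows "\<not> random_measure_expansive P theta f"
proof
  assume exp: "random_measure_expansive P theta f"
  interpret P: prob_space P by (rule prob_space_P)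
  interpret U: prob_space index_parameter by (rule prob_space_index_parameter)
  note [measurable] = K(1)
  obtain w0 where w0: "w0 \<in> K" using K(2) by (metis all_not_in_conv emeasure_empty)
  \<comment> \<open>outside \<open>K\<close> any non-atomic measure serves, for instance the one over a fixed point \<open>w0\<close> of \<open>K\<close>\<close>
  define r where "r w = (if w \<in> K then w else w0)" for w
  have [measurable]: "r \<in> P \<rightarrow>\<^sub>M P" unfolding r_def by measurable
  have rK: "r w \<in> K" for w using w0 by (simp add: r_def)
  define \<psi> where "\<psi> w p = \<phi> (fst p) (r w) (snd p)" for w and p :: "nat \<times> real"
  have \<psi>: "(\<lambda>(w, p). \<psi> w p) \<in> P \<Otimes>\<^sub>M index_parameter \<rightarrow>\<^sub>M borel"
  proof -
    have fs: "(\<lambda>q. fst (snd q)) \<in> P \<Otimes>\<^sub>M index_parameter \<rightarrow>\<^sub>M count_space UNIV"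
      by measurable
    have "(\<lambda>q. \<phi> n (r (fst q)) (snd (snd q))) \<in> borel_measurable (P \<Otimes>\<^sub>M index_parameter)" for n
    proof -
      have "(\<lambda>q. (r (fst q), snd (snd q))) \<in> P \<Otimes>\<^sub>M index_parameter \<rightarrow>\<^sub>M P \<Otimes>\<^sub>M borel"
        by measurable
      from measurable_compose[OF this meas[of n]] show ?thesis by simp
    qed
    from measurable_compose_countable[where f="\<lambda>n q. \<phi> n (r (fst q)) (snd (snd q))", OF this fs]
    show ?thesis by (simp add: \<psi>_def case_prod_beta)
  qed
  have \<psi>w: "\<psi> w \<in> index_parameter \<rightarrow>\<^sub>M borel" for w
    using measurable_compose_Pair1[OF _ \<psi>, of w] by simp
  define \<kappa> where "\<kappa> w = distr index_parameter borel (\<psi> w)" for w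
  have \<kappa>m: "\<kappa> \<in> P \<rightarrow>\<^sub>M prob_algebra borel"
    unfolding \<kappa>_def[abs_def]
  proof (rule measurable_distr_prob_space2[OF _ \<psi>])
    show "(\<lambda>_. index_parameter) \<in> P \<rightarrow>\<^sub>M prob_algebra index_parameter"
      by (rule measurable_const) (simp add: space_prob_algebra prob_space_index_parameter)
  qed
  have \<kappa>e: "emeasure (\<kappa> w) B = emeasure index_parameter (\<psi> w -` B)" if "B \<in> sets borel" for w B
    using emeasure_distr[OF \<psi>w that] by (simp add: \<kappa>_def)
  have vm: "\<psi> w -` B \<in> sets index_parameter" if "B \<in> sets borel" for w B
    using measurable_sets[OF \<psi>w that] by simp
  have nonat: "nonatomic (\<kappa> w)" for w
  proof (rule nonatomic_if_singletons_null)
    show "finite_measure (\<kappa> w)"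
      unfolding \<kappa>_def by (intro prob_space.finite_measure U.prob_space_distr \<psi>w)
    show "sets (\<kappa> w) = sets borel" by (simp add: \<kappa>_def)
    fix y
    have "emeasure index_parameter (\<psi> w -` {y}) = 0"
    proof (rule index_parameter_null[OF vm])
      fix n
      have "\<exists>t. Pair n -` (\<psi> w -` {y}) \<inter> {0..<1} \<subseteq> {t}"
        using inj[OF rK[of w], of n] unfolding \<psi>_def inj_on_def by (auto simp: vimage_def)
      then show "countable (Pair n -` (\<psi> w -` {y}) \<inter> {0..<1})"
        by (meson countable_finite finite.emptyI finite.insertI finite_subset)
    qed simp
    then show "emeasure (\<kappa> w) {y} = 0" by (simp add: \<kappa>e)
  qed
  define g where "g = (\<lambda>(w, p). (w, \<psi> w p))"
  have g: "g \<in> P \<Otimes>\<^sub>M index_parameter \<rightarrow>\<^sub>M P \<Otimes>\<^sub>M borel"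
    unfolding g_def case_prod_beta using \<psi>[unfolded case_prod_beta] by measurable
  define \<mu> where "\<mu> = distr (P \<Otimes>\<^sub>M index_parameter) (P \<Otimes>\<^sub>M borel) g"
  interpret PU: pair_prob_space P index_parameter ..
  have s\<mu>: "sets \<mu> = sets (P \<Otimes>\<^sub>M borel)" by (simp add: \<mu>_def)
  have \<mu>e: "emeasure \<mu> C = (\<integral>\<^sup>+ w. emeasure (\<kappa> w) (Pair w -` C) \<partial>P)" if C: "C \<in> sets \<mu>" for C
  proof -
    have C': "C \<in> sets (P \<Otimes>\<^sub>M borel)" using C s\<mu> by simp
    have "emeasure \<mu> C = emeasure (P \<Otimes>\<^sub>M index_parameter) (g -` C \<inter> space (P \<Otimes>\<^sub>M index_parameter))"
      unfolding \<mu>_def by (rule emeasure_distr[OF g C'])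
    also have "\<dots> = (\<integral>\<^sup>+ w. emeasure index_parameter (Pair w -` (g -` C \<inter> space (P \<Otimes>\<^sub>M index_parameter))) \<partial>P)"
      by (rule U.emeasure_pair_measure_alt[OF measurable_sets[OF g C']])
    also have "\<dots> = (\<integral>\<^sup>+ w. emeasure (\<kappa> w) (Pair w -` C) \<partial>P)"
    proof (rule nn_integral_cong)
      fix w
      have "Pair w -` (g -` C \<inter> space (P \<Otimes>\<^sub>M index_parameter)) = \<psi> w -` (Pair w -` C)"
        by (auto simp: g_def space_pair_measure)
      moreover have "Pair w -` C \<in> sets borel" using sets_Pair1[OF C'] .
      ultimately show "emeasure index_parameter (Pair w -` (g -` C \<inter> space (P \<Otimes>\<^sub>M index_parameter))) = emeasure (\<kappa> w) (Pair w -` C)"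
        by (simp add: \<kappa>e)
    qed
    finally show ?thesis .
  qed
  have dis: "disintegration P \<mu> \<kappa>" using \<kappa>m \<mu>e by (simp add: disintegration_def)
  have \<mu>: "\<mu> \<in> marginal_measures P"
    unfolding marginal_measures_def
  proof (intro CollectI conjI s\<mu>)
    show "prob_space \<mu>" unfolding \<mu>_def by (rule PU.prob_space_distr[OF g])
    show "distr \<mu> P fst = P"
    proof (rule measure_eqI)
      fix A assume "A \<in> sets (distr \<mu> P fst)"
      then have A: "A \<in> sets P" by simp
      have fm: "fst \<in> \<mu> \<rightarrow>\<^sub>M P" using measurable_fst measurable_cong_sets[OF s\<mu> refl] by blast
      have "emeasure (distr \<mu> P fst) A = emeasure \<mu> (fst -` A \<inter> space \<mu>)"
        by (rule emeasure_distr[OF fm A])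
      also have "\<dots> = (\<integral>\<^sup>+ w. emeasure (\<kappa> w) (Pair w -` (fst -` A \<inter> space \<mu>)) \<partial>P)"
        by (rule \<mu>e[OF measurable_sets[OF fm A]])
      also have "\<dots> = (\<integral>\<^sup>+ w. indicator A w \<partial>P)"
      proof (rule nn_integral_cong)
        fix w
        have sp: "space \<mu> = UNIV" by (simp add: \<mu>_def space_pair_measure)
        have "emeasure (\<kappa> w) UNIV = 1"
          using prob_space.emeasure_space_1[OF U.prob_space_distr[OF \<psi>w[of w]]] by (simp add: \<kappa>_def)
        then show "emeasure (\<kappa> w) (Pair w -` (fst -` A \<inter> space \<mu>)) = indicator A w"
          by (cases "w \<in> A") (simp_all add: sp vimage_def)
      qed
      also have "\<dots> = emeasure P A" using A by simp
      finally show "emeasure (distr \<mu> P fst) A = emeasure P A" .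
    qed simp
  qed
  have "nonatomic_factorization P \<mu>"
    using dis nonat by (auto simp: nonatomic_factorization_def)
  then have "random_expansive_measure P theta f \<mu>"
    using exp \<mu> by (simp add: random_measure_expansive_def)
  then obtain \<delta> \<kappa>' where d: "positive_rv P \<delta>" "disintegration P \<mu> \<kappa>'"
    "AE w in P. \<forall>x. emeasure (\<kappa>' w) (dyn_ball theta f \<delta> x w) = 0"
    by (auto simp: random_expansive_measure_def)
  have eqk: "AE w in P. \<kappa>' w = \<kappa> w"
    by (rule disintegration_unique[OF prob_space_P \<mu> d(2) dis])
  have "AE w in P. w \<notin> K"
    using d(3) eqk
  proof (rule AE_mp[OF AE_conjI], intro AE_I2 impI notI)
    fix w assume D: "(\<forall>x. emeasure (\<kappa>' w) (dyn_ball theta f \<delta> x w) = 0) \<and> \<kappa>' w = \<kappa> w" and w: "w \<in> K"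
    have rw: "r w = w" using w by (simp add: r_def)
    \<comment> \<open>nonempty shadow relations exist only over periodic points\<close>
    obtain x0 where "\<forall>t\<in>{0..<1}. (x0, \<phi> 0 w t) \<in> shadow_pairs 0 w"
      using shadow[OF w, of 0] by blast
    then have "(x0, \<phi> 0 w 0) \<in> shadow_pairs 0 w" by simp
    then have per: "periodic theta w" by (simp add: shadow_pairs_def)
    obtain n where n: "\<And>k. 1 / (real n + 1) \<le> \<delta> (base_pow theta k w)"
      using periodic_orbit_lower_bound[OF d(1) per] by blast
    obtain x where x: "\<And>t. t \<in> {0..<1} \<Longrightarrow> (x, \<phi> n w t) \<in> shadow_pairs n w"
      using shadow[OF w, of n] by blast
    have "{n} \<times> {0..<1} \<subseteq> \<psi> w -` dyn_ball theta f \<delta> x w"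
    proof
      fix p assume p: "p \<in> {n} \<times> {0..<1::real}"
      then have "(x, \<psi> w p) \<in> shadow_pairs n w" using x[of "snd p"] by (auto simp: \<psi>_def rw)
      then show "p \<in> \<psi> w -` dyn_ball theta f \<delta> x w"
        using n by (auto simp: shadow_pairs_def dyn_ball_def intro: order_trans)
    qed
    moreover have b: "dyn_ball theta f \<delta> x w \<in> sets borel"
      using closed_dyn_ball[of f, OF homeo_f] by (rule borel_closed)
    ultimately have "emeasure index_parameter (\<psi> w -` dyn_ball theta f \<delta> x w) \<noteq> 0"
      by (intro index_parameter_pos vm)
    then have "emeasure (\<kappa> w) (dyn_ball theta f \<delta> x w) \<noteq> 0" by (simp add: \<kappa>e[OF b])
    then show False using D by metis
  qed
  then show False using AE_iff_null_sets[OF K(1)] K(2) by (simp add: null_sets_def)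
qed

text \<open>The intersection of the inner sets \<open>C n\<close> is null, as it would otherwise support a measure that no \<open>\<delta>\<close> makes
  expansive. The hulls \<open>H n\<close> exceed the inner sets by null sets, so their intersection is null as well.\<close>

lemma measure_imp_countably_expansive:
  assumes "random_measure_expansive P theta f"
  shows "random_countably_expansive P theta f"
proof -
  interpret prob_space P by (rule prob_space_P)
  define good where "good n C H \<phi> \<longleftrightarrow> C \<in> sets P \<and> H \<in> sets P \<and> emeasure P (H - C) = 0 \<and>
      {w \<in> space P. \<exists>x. uncountable {y. (x, y) \<in> shadow_pairs n w}} \<subseteq> H \<and>
      (\<lambda>(w, t). \<phi> w t) \<in> P \<Otimes>\<^sub>M borel \<rightarrow>\<^sub>M borel \<and>
      (\<forall>w\<in>C. inj_on (\<phi> w) {0..<1::real}) \<and>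
      (\<forall>w\<in>C. \<exists>x. \<forall>t\<in>{0..<1}. (x, \<phi> w t) \<in> shadow_pairs n w)" for n C H \<phi>
  have "\<exists>C H \<phi>. good n C H \<phi>" for n
  proof (rule uncountable_section_uniformization[where M=P and E="shadow_pairs n"])
    show "finite_measure P" by (rule finite_measure_axioms)
    show "closed (shadow_pairs n w)" for w by (rule closed_shadow_pairs)
    show "{w \<in> space P. shadow_pairs n w \<inter> F \<noteq> {}} \<in> sets P" if "closed F" for F
      using that by (rule sets_shadow_pairs_hit)
  next
    fix C H and \<phi> :: "'w \<Rightarrow> real \<Rightarrow> 'x"
    assume "C \<in> sets P" "H \<in> sets P" "emeasure P (H - C) = 0"
      "{w \<in> space P. \<exists>x. uncountable {y. (x, y) \<in> shadow_pairs n w}} \<subseteq> H"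
      "(\<lambda>(w, t). \<phi> w t) \<in> P \<Otimes>\<^sub>M borel \<rightarrow>\<^sub>M borel"
      "\<And>w. w \<in> C \<Longrightarrow> inj_on (\<phi> w) {0..<1}"
      "\<And>w. w \<in> C \<Longrightarrow> \<exists>x. \<forall>t\<in>{0..<1}. (x, \<phi> w t) \<in> shadow_pairs n w"
    then have "good n C H \<phi>" unfolding good_def by (intro conjI ballI)
    then show "\<exists>C H \<phi>. good n C H \<phi>" by (intro exI)
  qed
  then have "\<forall>n. \<exists>C H \<phi>. good n C H \<phi>" by (rule allI)
  from choice[OF this] obtain C where "\<forall>n. \<exists>H \<phi>. good n (C n) H \<phi>" by (elim exE)
  from choice[OF this] obtain H where "\<forall>n. \<exists>\<phi>. good n (C n) (H n) \<phi>" by (elim exE)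
  from choice[OF this] obtain \<phi> where g: "\<forall>n. good n (C n) (H n) (\<phi> n)" by (elim exE)
  have C: "\<And>n. C n \<in> sets P" and H: "\<And>n. H n \<in> sets P" and HC: "\<And>n. emeasure P (H n - C n) = 0"
    and unc: "\<And>n. {w \<in> space P. \<exists>x. uncountable {y. (x, y) \<in> shadow_pairs n w}} \<subseteq> H n"
    and \<phi>: "\<And>n. (\<lambda>(w, t). \<phi> n w t) \<in> P \<Otimes>\<^sub>M borel \<rightarrow>\<^sub>M borel"
    and inj: "\<And>n w. w \<in> C n \<Longrightarrow> inj_on (\<phi> n w) {0..<1::real}"
    and sh: "\<And>n w. w \<in> C n \<Longrightarrow> \<exists>x. \<forall>t\<in>{0..<1}. (x, \<phi> n w t) \<in> shadow_pairs n w"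
    using g unfolding good_def by simp_all
  have K: "(\<Inter>n. C n) \<in> sets P" using C by (intro sets.countable_INT) auto
  have "emeasure P (\<Inter>n. C n) = 0"
  proof (rule ccontr)
    assume "emeasure P (\<Inter>n. C n) \<noteq> 0"
    with K have "\<not> random_measure_expansive P theta f"
      by (rule not_measure_expansive_if_scrambled[where \<phi>=\<phi>]) (use \<phi> inj sh in auto)
    then show False using assms by simp
  qed
  then have "(\<Inter>n. C n) \<union> (\<Union>n. H n - C n) \<in> null_sets P"
    using K HC C H by (intro null_sets.Un null_sets_UN) (auto simp: null_sets_def)
  moreover have "{w \<in> space P. periodic theta w \<and> (\<forall>n. w \<in> H n)} \<subseteq> (\<Inter>n. C n) \<union> (\<Union>n. H n - C n)"
    by blast
  moreover have "{w \<in> space P. periodic theta w \<and> (\<forall>n. w \<in> H n)} \<in> sets P"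
    using H by measurable
  ultimately have "emeasure P {w \<in> space P. periodic theta w \<and> (\<forall>n. w \<in> H n)} = 0"
    using null_sets_subset by (metis (no_types, lifting) null_setsD1)
  with H unc show ?thesis by (rule countably_expansive_if_hulls_null)
qed

end

section \<open>Equivalence of the two notions\<close>

theorem theoremC:
  fixes P :: "'w::polish_space measure"
    and theta :: "'w \<Rightarrow> 'w"
    and f :: "'w \<Rightarrow> 'x::polish_space \<Rightarrow> 'x"
  assumes "continuous_homeo_rds P theta f"
  shows "random_countably_expansive P theta f \<longleftrightarrow> random_measure_expansive P theta f"
proof -
  interpret continuous_homeo_rds P theta f by fact
  show ?thesis
    using countably_imp_measure_expansive measure_imp_countably_expansive by blast
qed

end
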